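(* Let $(A_i,\cdot_i,\ast_i,\alpha_i)$ be Hom-Novikov-Poisson algebras for $i=1,2$, and let $A=A_1\otimes A_2$. Define a linear map $\alpha\colon A\to A$ and bilinear operations $\cdot,\ast$ on $A$ by \[ \alpha=\alpha_1\otimes\alpha_2, \] \[ (x_1\otimes x_2)\cdot(y_1\otimes y_2)=(x_1\cdot_1 y_1)\otimes(x_2\cdot_2 y_2), \] \[ (x_1\otimes x_2)\ast(y_1\otimes y_2)=(x_1\ast_1 y_1)\otimes(x_2\cdot_2 y_2)+(x_1\cdot_1 y_1)\otimes(x_2\ast_2 y_2) \] for $x_i,y_i\in A_i$. Then $(A,\cdot,\ast,\alpha)$ is a Hom-Novikov-Poisson algebra. Moreover, if both $A_1$ and $A_2$ are multiplicative, then $A$ is also multiplicative.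
   Context: Everything is over a fixed field $\mathbf{k}$ of characteristic $0$; $\otimes$ is over $\mathbf{k}$. A double Hom-algebra is a quadruple $(A,\cdot,\ast,\alpha)$ where $A$ is a $\mathbf{k}$-vector space, $\cdot$ and $\ast$ are bilinear operations $A\otimes A\to A$, and $\alpha\colon A\to A$ is a linear map (the twisting map). It is multiplicative if $\alpha(x\cdot y)=\alpha(x)\cdot\alpha(y)$ and $\alpha(x\ast y)=\alpha(x)\ast\alpha(y)$ for all $x,y$. A Hom-Novikov-Poisson algebra is a double Hom-algebra $(A,\cdot,\ast,\alpha)$ such that for all $x,y,z\in A$: (1) $(A,\cdot,\alpha)$ is a commutative Hom-associative algebra: $x\cdot y=y\cdot x$ and $(x\cdot y)\cdot\alpha(z)=\alpha(x)\cdot(y\cdot z)$; (2) $(A,\ast,\alpha)$ is a Hom-Novikov algebra: $(x\ast y)\ast\alpha(z)-\alpha(x)\ast(y\ast z)=(y\ast x)\ast\alpha(z)-\alpha(y)\ast(x\ast z)$ and $(x\ast y)\ast\alpha(z)=(x\ast z)\ast\alpha(y)$; (3) $(x\ast y)\cdot\alpha(z)-\alpha(x)\ast(y\cdot z)=(y\ast x)\cdot\alpha(z)-\alpha(y)\ast(x\cdot z)$; (4) $(x\cdot y)\ast\alpha(z)=(x\ast z)\cdot\alpha(y)$. *)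

theory Defs
  imports "Jordan_Normal_Form.Missing_VectorSpace" "HOL-Algebra.QuotRing"
begin

section \<open>The tensor product of two vector spaces\<close>

text \<open>
  Vector spaces over a field are \<^locale>\<open>vectorspace\<close>s, i.e. HOL-Algebra modules. The fields
  \<open>mult\<close> and \<open>one\<close> that the record type of modules inherits from rings play no role; they get
  dummy values below.
\<close>

definition free_space :: "('k, 'r) ring_scheme \<Rightarrow> 's set \<Rightarrow> ('k, 's \<Rightarrow> 'k) module" where
  "free_space K S = (ring.func_space K S)
     \<lparr>carrier := {f \<in> S \<rightarrow>\<^sub>E carrier K. finite {s \<in> S. f s \<noteq> \<zero>\<^bsub>K\<^esub>}}\<rparr>"

definition free_gen :: "('k, 'r) ring_scheme \<Rightarrow> 's set \<Rightarrow> 's \<Rightarrow> 's \<Rightarrow> 'k" where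
  "free_gen K S s = (\<lambda>t\<in>S. if t = s then \<one>\<^bsub>K\<^esub> else \<zero>\<^bsub>K\<^esub>)"

text \<open>The scalar multiplication on cosets follows the pattern of \<^const>\<open>rcoset_mult\<close>.\<close>

definition quotient_space ::
  "('k, 'r) ring_scheme \<Rightarrow> ('k, 'v, 'm) module_scheme \<Rightarrow> 'v set \<Rightarrow> ('k, 'v set) module" where
  "quotient_space K V W =
     \<lparr>carrier = a_rcosets\<^bsub>V\<^esub> W, mult = (\<lambda>X Y. W), one = W,
      zero = W, add = (\<lambda>X Y. X <+>\<^bsub>V\<^esub> Y),
      smult = (\<lambda>c X. \<Union>x\<in>X. W +>\<^bsub>V\<^esub> (c \<odot>\<^bsub>V\<^esub> x))\<rparr>"

definition tensor_relators ::
  "('k, 'r) ring_scheme \<Rightarrow> ('k, 'a, 'm) module_scheme \<Rightarrow> ('k, 'b, 'n) module_scheme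
     \<Rightarrow> ('a \<times> 'b \<Rightarrow> 'k) set" where
  "tensor_relators K V W =
     (let S = carrier V \<times> carrier W; F = free_space K S; e = free_gen K S in
        {e (x \<oplus>\<^bsub>V\<^esub> x', y) \<ominus>\<^bsub>F\<^esub> (e (x, y) \<oplus>\<^bsub>F\<^esub> e (x', y)) | x x' y.
            x \<in> carrier V \<and> x' \<in> carrier V \<and> y \<in> carrier W} \<union>
        {e (x, y \<oplus>\<^bsub>W\<^esub> y') \<ominus>\<^bsub>F\<^esub> (e (x, y) \<oplus>\<^bsub>F\<^esub> e (x, y')) | x y y'.
            x \<in> carrier V \<and> y \<in> carrier W \<and> y' \<in> carrier W} \<union>
        {e (c \<odot>\<^bsub>V\<^esub> x, y) \<ominus>\<^bsub>F\<^esub> c \<odot>\<^bsub>F\<^esub> e (x, y) | c x y.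
            c \<in> carrier K \<and> x \<in> carrier V \<and> y \<in> carrier W} \<union>
        {e (x, c \<odot>\<^bsub>W\<^esub> y) \<ominus>\<^bsub>F\<^esub> c \<odot>\<^bsub>F\<^esub> e (x, y) | c x y.
            c \<in> carrier K \<and> x \<in> carrier V \<and> y \<in> carrier W})"

definition tensor_null ::
  "('k, 'r) ring_scheme \<Rightarrow> ('k, 'a, 'm) module_scheme \<Rightarrow> ('k, 'b, 'n) module_scheme
     \<Rightarrow> ('a \<times> 'b \<Rightarrow> 'k) set" where
  "tensor_null K V W =
     LinearCombinations.module.span K (free_space K (carrier V \<times> carrier W))
       (tensor_relators K V W)"

definition tensor_space ::
  "('k, 'r) ring_scheme \<Rightarrow> ('k, 'a, 'm) module_scheme \<Rightarrow> ('k, 'b, 'n) module_scheme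
     \<Rightarrow> ('k, ('a \<times> 'b \<Rightarrow> 'k) set) module" where
  "tensor_space K V W =
     quotient_space K (free_space K (carrier V \<times> carrier W)) (tensor_null K V W)"

definition pure_tensor ::
  "('k, 'r) ring_scheme \<Rightarrow> ('k, 'a, 'm) module_scheme \<Rightarrow> ('k, 'b, 'n) module_scheme
     \<Rightarrow> 'a \<Rightarrow> 'b \<Rightarrow> ('a \<times> 'b \<Rightarrow> 'k) set" where
  "pure_tensor K V W x y =
     tensor_null K V W +>\<^bsub>free_space K (carrier V \<times> carrier W)\<^esub>
       free_gen K (carrier V \<times> carrier W) (x, y)"


section \<open>Hom-Novikov-Poisson algebras\<close>

text \<open>A bilinear operation on \<open>A\<close> together with a linear twisting map.\<close>

locale hom_algebra = vectorspace K A
  for K :: "('k, 'r) ring_scheme" and A :: "('k, 'a, 'm) module_scheme" (structure) +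
  fixes mul :: "'a \<Rightarrow> 'a \<Rightarrow> 'a" and \<alpha> :: "'a \<Rightarrow> 'a"
  assumes twist_linear: "linear_map K A A \<alpha>"
    and mul_linear_right: "x \<in> carrier A \<Longrightarrow> linear_map K A A (\<lambda>y. mul x y)"
    and mul_linear_left: "y \<in> carrier A \<Longrightarrow> linear_map K A A (\<lambda>x. mul x y)"

locale double_hom_algebra =
  dot: hom_algebra K A dot \<alpha> + star: hom_algebra K A star \<alpha>
  for K :: "('k, 'r) ring_scheme" and A :: "('k, 'a, 'm) module_scheme" (structure)
    and dot :: "'a \<Rightarrow> 'a \<Rightarrow> 'a" (infixl \<open>\<bullet>\<close> 70)
    and star :: "'a \<Rightarrow> 'a \<Rightarrow> 'a" (infixl \<open>\<star>\<close> 70)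
    and \<alpha> :: "'a \<Rightarrow> 'a"

locale multiplicative_double_hom_algebra = double_hom_algebra +
  assumes twist_dot: "\<lbrakk>x \<in> carrier A; y \<in> carrier A\<rbrakk> \<Longrightarrow> \<alpha> (x \<bullet> y) = \<alpha> x \<bullet> \<alpha> y"
    and twist_star: "\<lbrakk>x \<in> carrier A; y \<in> carrier A\<rbrakk> \<Longrightarrow> \<alpha> (x \<star> y) = \<alpha> x \<star> \<alpha> y"

locale commutative_hom_associative_algebra = hom_algebra K A dot \<alpha>
  for K :: "('k, 'r) ring_scheme" and A :: "('k, 'a, 'm) module_scheme" (structure)
    and dot :: "'a \<Rightarrow> 'a \<Rightarrow> 'a" (infixl \<open>\<bullet>\<close> 70)
    and \<alpha> :: "'a \<Rightarrow> 'a" +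
  assumes dot_commute: "\<lbrakk>x \<in> carrier A; y \<in> carrier A\<rbrakk> \<Longrightarrow> x \<bullet> y = y \<bullet> x"
    and hom_associative: "\<lbrakk>x \<in> carrier A; y \<in> carrier A; z \<in> carrier A\<rbrakk>
      \<Longrightarrow> (x \<bullet> y) \<bullet> \<alpha> z = \<alpha> x \<bullet> (y \<bullet> z)"

locale hom_novikov_algebra = hom_algebra K A star \<alpha>
  for K :: "('k, 'r) ring_scheme" and A :: "('k, 'a, 'm) module_scheme" (structure)
    and star :: "'a \<Rightarrow> 'a \<Rightarrow> 'a" (infixl \<open>\<star>\<close> 70)
    and \<alpha> :: "'a \<Rightarrow> 'a" +
  assumes hom_left_symmetric: "\<lbrakk>x \<in> carrier A; y \<in> carrier A; z \<in> carrier A\<rbrakk>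
      \<Longrightarrow> ((x \<star> y) \<star> \<alpha> z) \<ominus> (\<alpha> x \<star> (y \<star> z)) = ((y \<star> x) \<star> \<alpha> z) \<ominus> (\<alpha> y \<star> (x \<star> z))"
    and hom_right_commute: "\<lbrakk>x \<in> carrier A; y \<in> carrier A; z \<in> carrier A\<rbrakk>
      \<Longrightarrow> (x \<star> y) \<star> \<alpha> z = (x \<star> z) \<star> \<alpha> y"

locale hom_novikov_poisson_algebra =
  double_hom_algebra K A dot star \<alpha> +
  commutative_hom_associative_algebra K A dot \<alpha> +
  hom_novikov_algebra K A star \<alpha>
  for K :: "('k, 'r) ring_scheme" and A :: "('k, 'a, 'm) module_scheme" (structure)
    and dot :: "'a \<Rightarrow> 'a \<Rightarrow> 'a" (infixl \<open>\<bullet>\<close> 70)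
    and star :: "'a \<Rightarrow> 'a \<Rightarrow> 'a" (infixl \<open>\<star>\<close> 70)
    and \<alpha> :: "'a \<Rightarrow> 'a" +
  assumes star_dot_compat: "\<lbrakk>x \<in> carrier A; y \<in> carrier A; z \<in> carrier A\<rbrakk>
      \<Longrightarrow> ((x \<star> y) \<bullet> \<alpha> z) \<ominus> (\<alpha> x \<star> (y \<bullet> z)) = ((y \<star> x) \<bullet> \<alpha> z) \<ominus> (\<alpha> y \<star> (x \<bullet> z))"
    and dot_star_compat: "\<lbrakk>x \<in> carrier A; y \<in> carrier A; z \<in> carrier A\<rbrakk>
      \<Longrightarrow> (x \<bullet> y) \<star> \<alpha> z = (x \<star> z) \<bullet> \<alpha> y"


section \<open>The tensor product of two double Hom-algebras\<close>

text \<open>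
  The linear map \<open>\<alpha>\<close> and the bilinear operations \<open>dot\<close>, \<open>star\<close> on \<open>A\<^sub>1 \<otimes> A\<^sub>2\<close> are given by their
  values on pure tensors. This is a predicate rather than a function because their values outside
  the carrier are arbitrary.
\<close>

definition is_tensor_double_hom_algebra ::
  "('k, 'r) ring_scheme
     \<Rightarrow> ('k, 'a, 'm) module_scheme \<Rightarrow> ('a \<Rightarrow> 'a \<Rightarrow> 'a) \<Rightarrow> ('a \<Rightarrow> 'a \<Rightarrow> 'a) \<Rightarrow> ('a \<Rightarrow> 'a)
     \<Rightarrow> ('k, 'b, 'n) module_scheme \<Rightarrow> ('b \<Rightarrow> 'b \<Rightarrow> 'b) \<Rightarrow> ('b \<Rightarrow> 'b \<Rightarrow> 'b) \<Rightarrow> ('b \<Rightarrow> 'b)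
     \<Rightarrow> (('a \<times> 'b \<Rightarrow> 'k) set \<Rightarrow> ('a \<times> 'b \<Rightarrow> 'k) set \<Rightarrow> ('a \<times> 'b \<Rightarrow> 'k) set)
     \<Rightarrow> (('a \<times> 'b \<Rightarrow> 'k) set \<Rightarrow> ('a \<times> 'b \<Rightarrow> 'k) set \<Rightarrow> ('a \<times> 'b \<Rightarrow> 'k) set)
     \<Rightarrow> (('a \<times> 'b \<Rightarrow> 'k) set \<Rightarrow> ('a \<times> 'b \<Rightarrow> 'k) set) \<Rightarrow> bool" where
  "is_tensor_double_hom_algebra K A\<^sub>1 dot\<^sub>1 star\<^sub>1 \<alpha>\<^sub>1 A\<^sub>2 dot\<^sub>2 star\<^sub>2 \<alpha>\<^sub>2 dot star \<alpha> \<longleftrightarrow>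
     (let t = pure_tensor K A\<^sub>1 A\<^sub>2; A = tensor_space K A\<^sub>1 A\<^sub>2 in
        double_hom_algebra K A dot star \<alpha> \<and>
        (\<forall>x\<^sub>1 \<in> carrier A\<^sub>1. \<forall>x\<^sub>2 \<in> carrier A\<^sub>2. \<alpha> (t x\<^sub>1 x\<^sub>2) = t (\<alpha>\<^sub>1 x\<^sub>1) (\<alpha>\<^sub>2 x\<^sub>2)) \<and>
        (\<forall>x\<^sub>1 \<in> carrier A\<^sub>1. \<forall>x\<^sub>2 \<in> carrier A\<^sub>2. \<forall>y\<^sub>1 \<in> carrier A\<^sub>1. \<forall>y\<^sub>2 \<in> carrier A\<^sub>2.
           dot (t x\<^sub>1 x\<^sub>2) (t y\<^sub>1 y\<^sub>2) = t (dot\<^sub>1 x\<^sub>1 y\<^sub>1) (dot\<^sub>2 x\<^sub>2 y\<^sub>2)) \<and>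
        (\<forall>x\<^sub>1 \<in> carrier A\<^sub>1. \<forall>x\<^sub>2 \<in> carrier A\<^sub>2. \<forall>y\<^sub>1 \<in> carrier A\<^sub>1. \<forall>y\<^sub>2 \<in> carrier A\<^sub>2.
           star (t x\<^sub>1 x\<^sub>2) (t y\<^sub>1 y\<^sub>2) =
             t (star\<^sub>1 x\<^sub>1 y\<^sub>1) (dot\<^sub>2 x\<^sub>2 y\<^sub>2) \<oplus>\<^bsub>A\<^esub> t (dot\<^sub>1 x\<^sub>1 y\<^sub>1) (star\<^sub>2 x\<^sub>2 y\<^sub>2)))"

end

theory Submission
  imports Defs
begin

text \<open>
  Every element of \<open>A\<^sub>1 \<otimes> A\<^sub>2\<close> is a finite sum of pure tensors, and both
  sides of each identity to be proved are additive in every argument. So it suffices to check the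
  identities on pure tensors (\<open>tensor_induct2\<close>, \<open>tensor_induct3\<close>).

  On pure tensors each product expands into terms with one factor in \<open>A\<^sub>1\<close> and
  one in \<open>A\<^sub>2\<close>. Writing \<open>(x, y, z)\<close> for the associator-like difference
  \<open>(x \<star> y) \<star> \<alpha> z - \<alpha> x \<star> (y \<star> z)\<close> and \<open>[x, y, z]\<close> for \<open>(x \<star> y) \<bullet> \<alpha> z - \<alpha> x \<star> (y \<bullet> z)\<close>, the
  difference \<open>(x, y, z)\<close> for \<open>x = x\<^sub>1 \<otimes> x\<^sub>2\<close>, \<open>y = y\<^sub>1 \<otimes> y\<^sub>2\<close>, \<open>z = z\<^sub>1 \<otimes> z\<^sub>2\<close> is

  \<open>(x\<^sub>1, y\<^sub>1, z\<^sub>1) \<otimes> (x\<^sub>2 \<bullet> y\<^sub>2) \<bullet> \<alpha> z\<^sub>2 + [x\<^sub>1, y\<^sub>1, z\<^sub>1] \<otimes> (x\<^sub>2 \<bullet> y\<^sub>2) \<star> \<alpha> z\<^sub>2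
    + (x\<^sub>1 \<bullet> y\<^sub>1) \<star> \<alpha> z\<^sub>1 \<otimes> [x\<^sub>2, y\<^sub>2, z\<^sub>2] + (x\<^sub>1 \<bullet> y\<^sub>1) \<bullet> \<alpha> z\<^sub>1 \<otimes> (x\<^sub>2, y\<^sub>2, z\<^sub>2)\<close>

  (\<open>star_associator_pure\<close>). Every factor here is symmetric in \<open>x\<close> and \<open>y\<close>, by left symmetry, by the
  first compatibility condition, or by commutativity of \<open>\<bullet>\<close>; hence so is the sum. The mixed terms can be
  grouped in this way because \<open>\<alpha> x \<bullet> (y \<star> z) = (x \<bullet> y) \<star> \<alpha> z\<close>, a form of the second compatibility
  condition. The first compatibility condition for the tensor product has the same shape with two
  terms (\<open>star_dot_associator_pure\<close>). In \<open>(x \<star> y) \<star> \<alpha> z\<close>, exchanging \<open>y\<close> and \<open>z\<close> preserves the two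
  outer terms of the expansion and swaps the two mixed ones. The remaining identities and multiplicativity
  hold term by term and factor by factor.

  By the universal property of the tensor product
  (\<open>tensor_lift\<close>, \<open>linear_map_eqI\<close>), which is derived from the construction as a quotient of a free space,
  linear maps and bilinear operations on the factors induce ones on the tensor product
  (\<open>tensor_product_linear_maps\<close>, \<open>tensor_product_bilinear_maps\<close>). The operation \<open>\<star>\<close> is the sum of two
  induced operations.
\<close>

section \<open>Quotient spaces\<close>

lemma (in vectorspace) submodule_imp_abelian_subgroup:
  assumes "submodule K W V"
  shows "abelian_subgroup W V"
proof (rule abelian_subgroupI3)
  interpret W: submodule K W V by fact
  show "additive_subgroup W V"
  proof (rule additive_subgroupI, rule add.subgroupI)
    show "W \<noteq> {}" using W.zero_closed by blast
  next
    fix a assume a: "a \<in> W"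
    then have "\<ominus>\<^bsub>V\<^esub> a = (\<ominus>\<^bsub>K\<^esub> \<one>\<^bsub>K\<^esub>) \<odot>\<^bsub>V\<^esub> a"
      using W.subset by (subst smult_minus_1) auto
    then show "\<ominus>\<^bsub>V\<^esub> a \<in> W" using a by simp
  qed (use W.subset in auto)
  show "abelian_group V" ..
qed

context vectorspace
begin

context
  fixes W
  assumes W: "submodule K W V"
begin

interpretation W: abelian_subgroup W V
  using W by (rule submodule_imp_abelian_subgroup)

lemma quotient_space_carrier:
  "carrier (quotient_space K V W) = (\<lambda>v. W +>\<^bsub>V\<^esub> v) ` carrier V"
  by (auto simp: quotient_space_def A_RCOSETS_def')

lemma quotient_space_zero: "\<zero>\<^bsub>quotient_space K V W\<^esub> = W +>\<^bsub>V\<^esub> \<zero>\<^bsub>V\<^esub>"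
  using submodule.subset[OF W] by (simp add: quotient_space_def)

lemma quotient_space_add:
  assumes "u \<in> carrier V" "v \<in> carrier V"
  shows "(W +>\<^bsub>V\<^esub> u) \<oplus>\<^bsub>quotient_space K V W\<^esub> (W +>\<^bsub>V\<^esub> v) = W +>\<^bsub>V\<^esub> (u \<oplus>\<^bsub>V\<^esub> v)"
  using assms by (simp add: quotient_space_def W.a_rcos_sum)

text \<open>
  Since \<open>W\<close> is closed under scalars, scaling the representatives of a coset of \<open>W\<close> leads into a
  single coset, so the union that defines the scalar multiplication of cosets collapses.
\<close>

lemma quotient_space_smult:
  assumes c: "c \<in> carrier K" and v: "v \<in> carrier V"
  shows "c \<odot>\<^bsub>quotient_space K V W\<^esub> (W +>\<^bsub>V\<^esub> v) = W +>\<^bsub>V\<^esub> (c \<odot>\<^bsub>V\<^esub> v)"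
proof -
  have "W +>\<^bsub>V\<^esub> (c \<odot>\<^bsub>V\<^esub> x) = W +>\<^bsub>V\<^esub> (c \<odot>\<^bsub>V\<^esub> v)" if x: "x \<in> W +>\<^bsub>V\<^esub> v" for x
  proof -
    obtain h where h: "h \<in> W" "x = h \<oplus>\<^bsub>V\<^esub> v"
      using x by (auto simp: a_r_coset_def')
    then have "c \<odot>\<^bsub>V\<^esub> x = (c \<odot>\<^bsub>V\<^esub> h) \<oplus>\<^bsub>V\<^esub> (c \<odot>\<^bsub>V\<^esub> v)"
      using c v submodule.subset[OF W] by (auto simp: smult_r_distr)
    moreover have "c \<odot>\<^bsub>V\<^esub> h \<in> W"
      using W c h(1) by (rule submodule.smult_closed)
    ultimately have "c \<odot>\<^bsub>V\<^esub> x \<in> W +>\<^bsub>V\<^esub> (c \<odot>\<^bsub>V\<^esub> v)"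
      by (auto simp: a_r_coset_def')
    then show ?thesis
      using W.a_repr_independence' c v by auto
  qed
  moreover have "v \<in> W +>\<^bsub>V\<^esub> v" using v by (rule W.a_rcos_self)
  ultimately have "(\<Union>x\<in>W +>\<^bsub>V\<^esub> v. W +>\<^bsub>V\<^esub> (c \<odot>\<^bsub>V\<^esub> x)) = W +>\<^bsub>V\<^esub> (c \<odot>\<^bsub>V\<^esub> v)"
    by (intro UN_constant_eq) blast+
  then show ?thesis by (simp add: quotient_space_def)
qed

lemmas quotient_space_simps =
  quotient_space_carrier quotient_space_zero quotient_space_add quotient_space_smult

lemma quotient_space_vectorspace: "vectorspace K (quotient_space K V W)"
proof (rule vs_criteria)
  show "field K" ..
  show "\<forall>v\<in>carrier (quotient_space K V W). \<exists>v'\<in>carrier (quotient_space K V W).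
      v \<oplus>\<^bsub>quotient_space K V W\<^esub> v' = \<zero>\<^bsub>quotient_space K V W\<^esub>"
  proof
    fix u assume "u \<in> carrier (quotient_space K V W)"
    then obtain v where "v \<in> carrier V" "u = W +>\<^bsub>V\<^esub> v" 
      by (auto simp: quotient_space_carrier)
    then show "\<exists>v'\<in>carrier (quotient_space K V W).
      u \<oplus>\<^bsub>quotient_space K V W\<^esub> v' = \<zero>\<^bsub>quotient_space K V W\<^esub>"
      by (intro bexI[of _ "W +>\<^bsub>V\<^esub> (\<ominus>\<^bsub>V\<^esub> v)"])
        (auto simp: quotient_space_simps M.r_neg)
  qed
  show "\<forall>v w. v \<in> carrier (quotient_space K V W) \<and> w \<in> carrier (quotient_space K V W)
      \<longrightarrow> v \<oplus>\<^bsub>quotient_space K V W\<^esub> w = w \<oplus>\<^bsub>quotient_space K V W\<^esub> v"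
    by (clarsimp simp: quotient_space_simps) (metis M.a_comm)
qed (auto simp: quotient_space_simps M.a_assoc smult_l_distr smult_r_distr smult_assoc1
    )

lemma quotient_space_proj_linear:
  "linear_map K V (quotient_space K V W) (\<lambda>v. W +>\<^bsub>V\<^esub> v)"
proof -
  interpret Q: vectorspace K "quotient_space K V W"
    by (rule quotient_space_vectorspace)
  show ?thesis
    by unfold_locales (auto simp: module_hom_def quotient_space_simps)
qed

text \<open>
  A linear map that vanishes on \<open>W\<close> is constant on the cosets of \<open>W\<close>, so its value at an arbitrary
  representative defines the induced map.
\<close>

lemma quotient_space_lift:
  assumes f: "linear_map K V X f" and ker: "\<And>w. w \<in> W \<Longrightarrow> f w = \<zero>\<^bsub>X\<^esub>"
  obtains g where "linear_map K (quotient_space K V W) X g"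
    and "\<And>v. v \<in> carrier V \<Longrightarrow> g (W +>\<^bsub>V\<^esub> v) = f v"
proof -
  interpret f: linear_map K V X f by fact
  interpret Q: vectorspace K "quotient_space K V W"
    by (rule quotient_space_vectorspace)
  define g where "g Z = f (SOME v. v \<in> Z)" for Z
  have g: "g (W +>\<^bsub>V\<^esub> v) = f v" if v: "v \<in> carrier V" for v
  proof -
    have "v \<in> W +>\<^bsub>V\<^esub> v" using v by (rule W.a_rcos_self)
    then have "(SOME u. u \<in> W +>\<^bsub>V\<^esub> v) \<in> W +>\<^bsub>V\<^esub> v" by (rule someI)
    then obtain h where h: "h \<in> W" "(SOME u. u \<in> W +>\<^bsub>V\<^esub> v) = h \<oplus>\<^bsub>V\<^esub> v"
      by (auto simp: a_r_coset_def')
    then show ?thesis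
      using v submodule.subset[OF W] by (auto simp: g_def f.f_add ker)
  qed
  have "linear_map K (quotient_space K V W) X g"
    by unfold_locales (auto simp: module_hom_def quotient_space_simps g)
  then show thesis using g by (rule that)
qed

end

end

section \<open>Free vector spaces\<close>

context vectorspace
begin

lemma free_space_simps:
  "carrier (free_space K S) = {f \<in> S \<rightarrow>\<^sub>E carrier K. finite {s \<in> S. f s \<noteq> \<zero>\<^bsub>K\<^esub>}}"
  "\<zero>\<^bsub>free_space K S\<^esub> = (\<lambda>s\<in>S. \<zero>\<^bsub>K\<^esub>)"
  "f \<oplus>\<^bsub>free_space K S\<^esub> g = (\<lambda>s\<in>S. f s \<oplus>\<^bsub>K\<^esub> g s)"
  "c \<odot>\<^bsub>free_space K S\<^esub> f = (\<lambda>s\<in>S. c \<otimes>\<^bsub>K\<^esub> f s)"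
  by (simp_all add: free_space_def func_space_def)

lemma free_space_vectorspace: "vectorspace K (free_space K S)"
proof -
  interpret F: module K "func_space S"
    by (rule func_space_is_module)
  let ?N = "carrier (free_space K S)"
  have "submodule K ?N (func_space S)"
  proof
    show "?N \<subseteq> carrier (func_space S)"
      by (auto simp: free_space_simps func_space_def)
  next
    fix f g assume fg: "f \<in> ?N" "g \<in> ?N"
    then have "finite ({s \<in> S. f s \<noteq> \<zero>\<^bsub>K\<^esub>} \<union> {s \<in> S. g s \<noteq> \<zero>\<^bsub>K\<^esub>})"
      by (simp add: free_space_simps)
    then have "finite {s \<in> S. f s \<oplus>\<^bsub>K\<^esub> g s \<noteq> \<zero>\<^bsub>K\<^esub>}"
      by (rule rev_finite_subset) auto
    then show "f \<oplus>\<^bsub>func_space S\<^esub> g \<in> ?N"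
      using fg by (auto simp: free_space_simps func_space_def PiE_mem2 cong: conj_cong)
  next
    fix c f assume cf: "c \<in> carrier K" "f \<in> ?N"
    then have "finite {s \<in> S. f s \<noteq> \<zero>\<^bsub>K\<^esub>}"
      by (simp add: free_space_simps)
    then have "finite {s \<in> S. c \<otimes>\<^bsub>K\<^esub> f s \<noteq> \<zero>\<^bsub>K\<^esub>}"
      by (rule rev_finite_subset) (use cf in auto)
    then show "c \<odot>\<^bsub>func_space S\<^esub> f \<in> ?N"
      using cf by (auto simp: free_space_simps func_space_def PiE_mem2 cong: conj_cong)
  qed (auto simp: free_space_simps func_space_def)
  then have "module K (free_space K S)"
    using F.submodule_is_module by (simp add: free_space_def)
  then show ?thesis
    using field_axioms by (rule vectorspace.intro)
qed

lemma free_gen_closed: "s \<in> S \<Longrightarrow> free_gen K S s \<in> carrier (free_space K S)"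
  by (auto simp: free_gen_def free_space_simps cong: conj_cong)

text \<open>
  Removing one point at a time from the finite support exhausts a function in the free space.
\<close>

lemma free_space_induct [consumes 1, case_names zero step]:
  assumes f: "f \<in> carrier (free_space K S)"
    and zero: "P \<zero>\<^bsub>free_space K S\<^esub>"
    and step: "\<And>c s f. \<lbrakk>c \<in> carrier K; s \<in> S; f \<in> carrier (free_space K S); P f\<rbrakk>
      \<Longrightarrow> P (c \<odot>\<^bsub>free_space K S\<^esub> free_gen K S s \<oplus>\<^bsub>free_space K S\<^esub> f)"
  shows "P f"
proof -
  have "finite {s \<in> S. f s \<noteq> \<zero>\<^bsub>K\<^esub>}"
    using f by (simp add: free_space_simps)
  then show ?thesis
    using f
  proof (induction "{s \<in> S. f s \<noteq> \<zero>\<^bsub>K\<^esub>}" arbitrary: f rule: finite_induct)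
    case empty
    then have "f = (\<lambda>s\<in>S. \<zero>\<^bsub>K\<^esub>)"
      by (fastforce simp: free_space_simps PiE_def extensional_def restrict_def)
    with zero show ?case by (simp only: free_space_simps(2))
  next
    case (insert s T f)
    then have s: "s \<in> S" by blast
    let ?g = "f(s := \<zero>\<^bsub>K\<^esub>)"
    have T: "T = {t \<in> S. ?g t \<noteq> \<zero>\<^bsub>K\<^esub>}"
      using insert.hyps(2,4) by auto
    have g: "?g \<in> carrier (free_space K S)"
      using insert.prems s insert.hyps(1) T by (auto simp: free_space_simps PiE_def Pi_def extensional_def)
    have fs: "f s \<in> carrier K"
      using insert.prems s by (auto simp: free_space_simps)
    have "f = f s \<odot>\<^bsub>free_space K S\<^esub> free_gen K S s \<oplus>\<^bsub>free_space K S\<^esub> ?g"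
      using insert.prems s 
      by (auto simp: free_space_simps free_gen_def fun_eq_iff PiE_def extensional_def Pi_def)
    then show ?case
      using step[OF fs s g insert.hyps(3)[OF T g]] by simp
  qed
qed

text \<open>
  The extension sums \<open>f s \<cdot> b s\<close> over the support of \<open>f\<close>. By cancellation, the support of a sum of two
  functions can be smaller than the union of their supports; for additivity all sums are therefore
  extended to this union, which only adds zero terms.
\<close>

lemma free_space_lift:
  assumes X: "vectorspace K X" and b: "b \<in> S \<rightarrow> carrier X"
  obtains f where "linear_map K (free_space K S) X f"
    and "\<And>s. s \<in> S \<Longrightarrow> f (free_gen K S s) = b s"
proof -
  interpret X: vectorspace K X by fact
  interpret F: vectorspace K "free_space K S" by (rule free_space_vectorspace)
  define supp where "supp f = {s \<in> S. f s \<noteq> \<zero>\<^bsub>K\<^esub>}" for f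
  define ext where "ext f = (\<Oplus>\<^bsub>X\<^esub>s\<in>supp f. f s \<odot>\<^bsub>X\<^esub> b s)" for f
  have val: "f s \<in> carrier K" if "f \<in> carrier (free_space K S)" "s \<in> S" for f s
    using that by (auto simp: free_space_simps)
  have fin: "finite (supp f)" if "f \<in> carrier (free_space K S)" for f
    using that by (simp add: free_space_simps supp_def)
  have bs: "b s \<in> carrier X" if "s \<in> S" for s
    using b that by auto
  have ext_eq: "ext f = (\<Oplus>\<^bsub>X\<^esub>s\<in>T. f s \<odot>\<^bsub>X\<^esub> b s)"
    if "f \<in> carrier (free_space K S)" "finite T" "supp f \<subseteq> T" "T \<subseteq> S" for f T
    unfolding ext_def using that b
    by (intro X.M.add.finprod_mono_neutral_cong_left) (auto simp: supp_def val bs)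
  have "linear_map K (free_space K S) X ext"
  proof -
    have "ext f \<in> carrier X" if "f \<in> carrier (free_space K S)" for f
      unfolding ext_def using that by (intro X.M.finsum_closed) (auto simp: supp_def val bs)
    moreover have "ext (f \<oplus>\<^bsub>free_space K S\<^esub> g) = ext f \<oplus>\<^bsub>X\<^esub> ext g"
      if f: "f \<in> carrier (free_space K S)" and g: "g \<in> carrier (free_space K S)" for f g
    proof -
      let ?T = "supp f \<union> supp g"
      have T: "finite ?T" "?T \<subseteq> S" using fin f g by (auto simp: supp_def)
      have sum_supp: "supp (f \<oplus>\<^bsub>free_space K S\<^esub> g) \<subseteq> ?T"
        by (auto simp: supp_def free_space_simps)
      have "ext (f \<oplus>\<^bsub>free_space K S\<^esub> g)
          = (\<Oplus>\<^bsub>X\<^esub>s\<in>?T. f s \<odot>\<^bsub>X\<^esub> b s \<oplus>\<^bsub>X\<^esub> g s \<odot>\<^bsub>X\<^esub> b s)"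
        unfolding ext_eq[OF F.M.a_closed[OF f g] T(1) sum_supp T(2)]
        using T f g by (intro X.M.finsum_cong')
          (auto simp: free_space_simps(3) val bs X.smult_l_distr subset_iff)
      also have "\<dots> = (\<Oplus>\<^bsub>X\<^esub>s\<in>?T. f s \<odot>\<^bsub>X\<^esub> b s) \<oplus>\<^bsub>X\<^esub> (\<Oplus>\<^bsub>X\<^esub>s\<in>?T. g s \<odot>\<^bsub>X\<^esub> b s)"
        using T f g by (intro X.M.finsum_addf) (auto simp: val bs subset_iff)
      also have "\<dots> = ext f \<oplus>\<^bsub>X\<^esub> ext g"
        using T f g by (simp add: ext_eq[of _ ?T])
      finally show ?thesis .
    qed
    moreover have "ext (c \<odot>\<^bsub>free_space K S\<^esub> f) = c \<odot>\<^bsub>X\<^esub> ext f"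
      if c: "c \<in> carrier K" and f: "f \<in> carrier (free_space K S)" for c f
    proof -
      have T: "finite (supp f)" "supp f \<subseteq> S" using fin f by (auto simp: supp_def)
      have smult_supp: "supp (c \<odot>\<^bsub>free_space K S\<^esub> f) \<subseteq> supp f"
        using c by (auto simp: supp_def free_space_simps)
      have "ext (c \<odot>\<^bsub>free_space K S\<^esub> f) = (\<Oplus>\<^bsub>X\<^esub>s\<in>supp f. c \<odot>\<^bsub>X\<^esub> (f s \<odot>\<^bsub>X\<^esub> b s))"
        unfolding ext_eq[OF F.smult_closed[OF c f] T(1) smult_supp T(2)]
        using T c f by (intro X.M.finsum_cong')
          (auto simp: free_space_simps(4) val bs X.smult_assoc1 subset_iff)
      also have "\<dots> = c \<odot>\<^bsub>X\<^esub> ext f"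
        unfolding ext_def using T c f
        by (intro X.finsum_smult_ldistr[symmetric]) (auto simp: val bs subset_iff)
      finally show ?thesis .
    qed
    ultimately show ?thesis
      by unfold_locales (simp add: module_hom_def)
  qed
  moreover have "ext (free_gen K S s) = b s" if s: "s \<in> S" for s
  proof -
    have "ext (free_gen K S s) = (\<Oplus>\<^bsub>X\<^esub>t\<in>{s}. free_gen K S s t \<odot>\<^bsub>X\<^esub> b t)"
      using s by (intro ext_eq free_gen_closed) (auto simp: supp_def free_gen_def)
    then show ?thesis using s bs by (simp add: free_gen_def)
  qed
  ultimately show thesis by (rule that)
qed

end

section \<open>Linear and bilinear maps\<close>

lemma linear_mapI:
  assumes "vectorspace K V" "vectorspace K W"
    and "\<And>x. x \<in> carrier V \<Longrightarrow> T x \<in> carrier W"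
    and "\<And>x y. \<lbrakk>x \<in> carrier V; y \<in> carrier V\<rbrakk> \<Longrightarrow> T (x \<oplus>\<^bsub>V\<^esub> y) = T x \<oplus>\<^bsub>W\<^esub> T y"
    and "\<And>c x. \<lbrakk>c \<in> carrier K; x \<in> carrier V\<rbrakk> \<Longrightarrow> T (c \<odot>\<^bsub>V\<^esub> x) = c \<odot>\<^bsub>W\<^esub> T x"
  shows "linear_map K V W T"
  using assms
  by (simp add: linear_map_def mod_hom_def mod_hom_axioms_def vectorspace_def module_hom_def)

lemma linear_map_add:
  assumes "linear_map K V W S" "linear_map K V W T"
  shows "linear_map K V W (\<lambda>x. S x \<oplus>\<^bsub>W\<^esub> T x)"
proof -
  interpret W: vectorspace K W
    using assms(1) by (rule linear_map.axioms)
  interpret S: linear_map K V W S by fact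
  interpret T: linear_map K V W T by fact
  show ?thesis
    by (rule linear_mapI)
      (auto intro: S.V.vectorspace_axioms W.vectorspace_axioms
        simp: W.smult_r_distr W.M.a_ac)
qed

lemma linear_map_smult:
  assumes "linear_map K V W T" "c \<in> carrier K"
  shows "linear_map K V W (\<lambda>x. c \<odot>\<^bsub>W\<^esub> T x)"
proof -
  interpret W: vectorspace K W
    using assms(1) by (rule linear_map.axioms)
  interpret T: linear_map K V W T by fact
  show ?thesis
    using assms(2)
    by (intro linear_mapI)
      (auto intro: T.V.vectorspace_axioms W.vectorspace_axioms
        simp: W.smult_r_distr W.smult_assoc_simp W.R.m_comm)
qed

lemma linear_map_comp:
  assumes "linear_map K U V S" "linear_map K V W T"
  shows "linear_map K U W (\<lambda>x. T (S x))"
proof -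
  interpret S: linear_map K U V S by fact
  interpret T: linear_map K V W T by fact
  show ?thesis
    by (rule linear_mapI) (auto intro: S.V.vectorspace_axioms T.W.vectorspace_axioms)
qed

locale bilinear_map = V: vectorspace K V + W: vectorspace K W + X: vectorspace K X
  for K V W X +
  fixes b
  assumes linear_right: "x \<in> carrier V \<Longrightarrow> linear_map K W X (b x)"
    and linear_left: "y \<in> carrier W \<Longrightarrow> linear_map K V X (\<lambda>x. b x y)"
begin

context
  fixes x y assumes x: "x \<in> carrier V" and y: "y \<in> carrier W"
begin

interpretation left: linear_map K V X "\<lambda>x. b x y" using y by (rule linear_left)
interpretation right: linear_map K W X "b x" using x by (rule linear_right)

lemma closed [simp]: "b x y \<in> carrier X"
  using x by (rule left.f_im)

lemma add_left: "x' \<in> carrier V \<Longrightarrow> b (x \<oplus>\<^bsub>V\<^esub> x') y = b x y \<oplus>\<^bsub>X\<^esub> b x' y"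
  using x by (rule left.f_add)

lemma add_right: "y' \<in> carrier W \<Longrightarrow> b x (y \<oplus>\<^bsub>W\<^esub> y') = b x y \<oplus>\<^bsub>X\<^esub> b x y'"
  using y by (rule right.f_add)

lemma minus_left: "x' \<in> carrier V \<Longrightarrow> b (x \<ominus>\<^bsub>V\<^esub> x') y = b x y \<ominus>\<^bsub>X\<^esub> b x' y"
  using x by (rule left.f_minus)

lemma minus_right: "y' \<in> carrier W \<Longrightarrow> b x (y \<ominus>\<^bsub>W\<^esub> y') = b x y \<ominus>\<^bsub>X\<^esub> b x y'"
  using y by (rule right.f_minus)

lemma smult_left: "c \<in> carrier K \<Longrightarrow> b (c \<odot>\<^bsub>V\<^esub> x) y = c \<odot>\<^bsub>X\<^esub> b x y"
  using x by (rule left.f_smult[rotated])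

lemma smult_right: "c \<in> carrier K \<Longrightarrow> b x (c \<odot>\<^bsub>W\<^esub> y) = c \<odot>\<^bsub>X\<^esub> b x y"
  using y by (rule right.f_smult[rotated])

end

lemma zero_left: "y \<in> carrier W \<Longrightarrow> b \<zero>\<^bsub>V\<^esub> y = \<zero>\<^bsub>X\<^esub>"
  using minus_left[of "\<zero>\<^bsub>V\<^esub>" y "\<zero>\<^bsub>V\<^esub>"] by (simp add: a_minus_def V.M.r_neg X.M.r_neg)

end

lemma bilinear_mapI:
  assumes "vectorspace K V" "vectorspace K W" "vectorspace K X"
    and "\<And>x. x \<in> carrier V \<Longrightarrow> linear_map K W X (b x)"
    and "\<And>y. y \<in> carrier W \<Longrightarrow> linear_map K V X (\<lambda>x. b x y)"
  shows "bilinear_map K V W X b"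
  using assms by (intro bilinear_map.intro bilinear_map_axioms.intro)

lemma (in bilinear_map) comp_linear:
  assumes "linear_map K V' V f" "linear_map K W' W g"
  shows "bilinear_map K V' W' X (\<lambda>x y. b (f x) (g y))"
proof -
  interpret f: linear_map K V' V f by fact
  interpret g: linear_map K W' W g by fact
  show ?thesis
  proof (rule bilinear_mapI)
    fix x assume "x \<in> carrier V'"
    then show "linear_map K W' X (\<lambda>y. b (f x) (g y))"
      by (intro linear_map_comp[OF assms(2)] linear_right f.f_im)
  next
    fix y assume "y \<in> carrier W'"
    then show "linear_map K V' X (\<lambda>x. b (f x) (g y))"
      by (intro linear_map_comp[OF assms(1)] linear_left g.f_im)
  qed unfold_locales
qed

lemma bilinear_map_add:
  assumes "bilinear_map K V W X b" "bilinear_map K V W X b'"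
  shows "bilinear_map K V W X (\<lambda>x y. b x y \<oplus>\<^bsub>X\<^esub> b' x y)"
proof -
  interpret b: bilinear_map K V W X b by fact
  interpret b': bilinear_map K V W X b' by fact
  show ?thesis
  proof (rule bilinear_mapI)
    fix x assume "x \<in> carrier V"
    then show "linear_map K W X (\<lambda>y. b x y \<oplus>\<^bsub>X\<^esub> b' x y)"
      by (intro linear_map_add b.linear_right b'.linear_right)
  next
    fix y assume "y \<in> carrier W"
    then show "linear_map K V X (\<lambda>x. b x y \<oplus>\<^bsub>X\<^esub> b' x y)"
      by (intro linear_map_add b.linear_left b'.linear_left)
  qed unfold_locales
qed

section \<open>The universal property of the tensor product\<close>

locale tensor_product = V: vectorspace K V + W: vectorspace K W for K V W
begin

abbreviation "F \<equiv> free_space K (carrier V \<times> carrier W)"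
abbreviation "e \<equiv> free_gen K (carrier V \<times> carrier W)"
abbreviation "N \<equiv> tensor_null K V W"
abbreviation "T \<equiv> tensor_space K V W"
abbreviation "t \<equiv> pure_tensor K V W"

sublocale F: vectorspace K F by (rule V.free_space_vectorspace)

text \<open>
  These are the four families that generate the null space, in the form of membership rules, which
  spares every later use a search through a union of set comprehensions.
\<close>

lemma relators_mem:
  "\<lbrakk>x \<in> carrier V; x' \<in> carrier V; y \<in> carrier W\<rbrakk>
    \<Longrightarrow> e (x \<oplus>\<^bsub>V\<^esub> x', y) \<ominus>\<^bsub>F\<^esub> (e (x, y) \<oplus>\<^bsub>F\<^esub> e (x', y)) \<in> tensor_relators K V W"
  "\<lbrakk>x \<in> carrier V; y \<in> carrier W; y' \<in> carrier W\<rbrakk>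
    \<Longrightarrow> e (x, y \<oplus>\<^bsub>W\<^esub> y') \<ominus>\<^bsub>F\<^esub> (e (x, y) \<oplus>\<^bsub>F\<^esub> e (x, y')) \<in> tensor_relators K V W"
  "\<lbrakk>c \<in> carrier K; x \<in> carrier V; y \<in> carrier W\<rbrakk>
    \<Longrightarrow> e (c \<odot>\<^bsub>V\<^esub> x, y) \<ominus>\<^bsub>F\<^esub> c \<odot>\<^bsub>F\<^esub> e (x, y) \<in> tensor_relators K V W"
  "\<lbrakk>c \<in> carrier K; x \<in> carrier V; y \<in> carrier W\<rbrakk>
    \<Longrightarrow> e (x, c \<odot>\<^bsub>W\<^esub> y) \<ominus>\<^bsub>F\<^esub> c \<odot>\<^bsub>F\<^esub> e (x, y) \<in> tensor_relators K V W"
  unfolding tensor_relators_def Let_def by blast+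

lemma relators_subset: "tensor_relators K V W \<subseteq> carrier F"
  by (auto simp: tensor_relators_def Let_def intro!: V.free_gen_closed F.M.minus_closed F.smult_closed)

lemma null_submodule: "submodule K N F"
  unfolding tensor_null_def using relators_subset by (rule F.span_is_submodule)

sublocale T: vectorspace K T
  unfolding tensor_space_def using null_submodule by (rule F.quotient_space_vectorspace)

lemma proj_linear: "linear_map K F T (\<lambda>f. N +>\<^bsub>F\<^esub> f)"
  unfolding tensor_space_def using null_submodule by (rule F.quotient_space_proj_linear)

interpretation proj: linear_map K F T "\<lambda>f. N +>\<^bsub>F\<^esub> f" by (rule proj_linear)

lemma proj_eq:
  assumes "f \<ominus>\<^bsub>F\<^esub> g \<in> tensor_relators K V W" "f \<in> carrier F" "g \<in> carrier F"
  shows "N +>\<^bsub>F\<^esub> f = N +>\<^bsub>F\<^esub> g"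
proof -
  interpret N: abelian_subgroup N F
    using null_submodule by (rule F.submodule_imp_abelian_subgroup)
  have "f \<ominus>\<^bsub>F\<^esub> g \<in> N"
    unfolding tensor_null_def using F.in_own_span[OF relators_subset] assms(1) by blast
  then show ?thesis
    using N.a_rcos_module[of g f] N.a_repr_independence'[of f g] assms(2,3)
    by (simp add: a_minus_def)
qed

lemma pure_bilinear: "bilinear_map K V W T t"
proof (rule bilinear_mapI)
  fix x assume x: "x \<in> carrier V"
  show "linear_map K W T (t x)"
  proof (rule linear_mapI)
    fix y y' assume y: "y \<in> carrier W" "y' \<in> carrier W"
    have "N +>\<^bsub>F\<^esub> e (x, y \<oplus>\<^bsub>W\<^esub> y') = N +>\<^bsub>F\<^esub> (e (x, y) \<oplus>\<^bsub>F\<^esub> e (x, y'))"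
      using x y by (intro proj_eq relators_mem) (auto simp: V.free_gen_closed)
    then show "t x (y \<oplus>\<^bsub>W\<^esub> y') = t x y \<oplus>\<^bsub>T\<^esub> t x y'"
      using x y by (simp add: pure_tensor_def proj.f_add V.free_gen_closed)
  next
    fix c y assume c: "c \<in> carrier K" and y: "y \<in> carrier W"
    have "N +>\<^bsub>F\<^esub> e (x, c \<odot>\<^bsub>W\<^esub> y) = N +>\<^bsub>F\<^esub> (c \<odot>\<^bsub>F\<^esub> e (x, y))"
      using x c y by (intro proj_eq relators_mem) (auto simp: V.free_gen_closed)
    then show "t x (c \<odot>\<^bsub>W\<^esub> y) = c \<odot>\<^bsub>T\<^esub> t x y"
      using x c y by (simp add: pure_tensor_def proj.f_smult V.free_gen_closed)
  qed (use x in \<open>auto simp: pure_tensor_def V.free_gen_closed W.vectorspace_axioms T.vectorspace_axioms\<close>)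
next
  fix y assume y: "y \<in> carrier W"
  show "linear_map K V T (\<lambda>x. t x y)"
  proof (rule linear_mapI)
    fix x x' assume x: "x \<in> carrier V" "x' \<in> carrier V"
    have "N +>\<^bsub>F\<^esub> e (x \<oplus>\<^bsub>V\<^esub> x', y) = N +>\<^bsub>F\<^esub> (e (x, y) \<oplus>\<^bsub>F\<^esub> e (x', y))"
      using x y by (intro proj_eq relators_mem) (auto simp: V.free_gen_closed)
    then show "t (x \<oplus>\<^bsub>V\<^esub> x') y = t x y \<oplus>\<^bsub>T\<^esub> t x' y"
      using x y by (simp add: pure_tensor_def proj.f_add V.free_gen_closed)
  next
    fix c x assume c: "c \<in> carrier K" and x: "x \<in> carrier V"
    have "N +>\<^bsub>F\<^esub> e (c \<odot>\<^bsub>V\<^esub> x, y) = N +>\<^bsub>F\<^esub> (c \<odot>\<^bsub>F\<^esub> e (x, y))"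
      using x c y by (intro proj_eq relators_mem) (auto simp: V.free_gen_closed)
    then show "t (c \<odot>\<^bsub>V\<^esub> x) y = c \<odot>\<^bsub>T\<^esub> t x y"
      using x c y by (simp add: pure_tensor_def proj.f_smult V.free_gen_closed)
  qed (use y in \<open>auto simp: pure_tensor_def V.free_gen_closed V.vectorspace_axioms T.vectorspace_axioms\<close>)
qed unfold_locales

sublocale pure: bilinear_map K V W T t by (rule pure_bilinear)

text \<open>
  There is no case for scalar multiples, since a scalar can be moved into the left factor of a pure
  tensor; zero is the pure tensor of two zeros.
\<close>

lemma tensor_induct [consumes 1, case_names pure add]:
  assumes u: "u \<in> carrier T"
    and pure: "\<And>x y. \<lbrakk>x \<in> carrier V; y \<in> carrier W\<rbrakk> \<Longrightarrow> P (t x y)"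
    and add: "\<And>u v. \<lbrakk>u \<in> carrier T; v \<in> carrier T; P u; P v\<rbrakk> \<Longrightarrow> P (u \<oplus>\<^bsub>T\<^esub> v)"
  shows "P u"
proof -
  obtain f where f: "f \<in> carrier F" "u = N +>\<^bsub>F\<^esub> f"
    using u unfolding tensor_space_def F.quotient_space_carrier[OF null_submodule] by blast
  have "P (N +>\<^bsub>F\<^esub> f)"
    using f(1)
  proof (induction rule: V.free_space_induct)
    case zero
    have "P (t \<zero>\<^bsub>V\<^esub> \<zero>\<^bsub>W\<^esub>)" by (rule pure) auto
    then show ?case
      by (simp add: pure.zero_left)
  next
    case (step c s f)
    then obtain x y where s: "s = (x, y)" "x \<in> carrier V" "y \<in> carrier W" by auto
    have "N +>\<^bsub>F\<^esub> (c \<odot>\<^bsub>F\<^esub> e s \<oplus>\<^bsub>F\<^esub> f) = c \<odot>\<^bsub>T\<^esub> t x y \<oplus>\<^bsub>T\<^esub> (N +>\<^bsub>F\<^esub> f)"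
      using step.hyps s by (simp add: V.free_gen_closed pure_tensor_def)
    also have "\<dots> = t (c \<odot>\<^bsub>V\<^esub> x) y \<oplus>\<^bsub>T\<^esub> (N +>\<^bsub>F\<^esub> f)"
      using step.hyps s by (simp add: pure.smult_left)
    finally show ?case
      using step s by (simp add: add pure)
  qed
  then show ?thesis by (simp add: f(2))
qed

text \<open>
  Uniqueness in the universal property: pure tensors generate the tensor product.
\<close>

lemma linear_map_eqI:
  assumes f: "linear_map K T X f" and g: "linear_map K T X g"
    and eq: "\<And>x y. \<lbrakk>x \<in> carrier V; y \<in> carrier W\<rbrakk> \<Longrightarrow> f (t x y) = g (t x y)"
    and u: "u \<in> carrier T"
  shows "f u = g u"
proof -
  interpret f: linear_map K T X f by fact
  interpret g: linear_map K T X g by fact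
  from u show ?thesis by (induction rule: tensor_induct) (auto simp: eq)
qed

text \<open>
  Existence in the universal property: the relators express exactly the bilinearity of the pairing, so
  the linear extension of a bilinear map to the free space kills the null space.
\<close>

lemma tensor_lift:
  assumes "bilinear_map K V W X b"
  obtains f where "linear_map K T X f"
    and "\<And>x y. \<lbrakk>x \<in> carrier V; y \<in> carrier W\<rbrakk> \<Longrightarrow> f (t x y) = b x y"
proof -
  interpret b: bilinear_map K V W X b by fact
  have case_prod_closed: "case_prod b \<in> carrier V \<times> carrier W \<rightarrow> carrier X" by auto
  obtain g where g: "linear_map K F X g"
    and g_gen: "\<And>s. s \<in> carrier V \<times> carrier W \<Longrightarrow> g (e s) = case_prod b s"
    using V.free_space_lift[OF b.X.vectorspace_axioms case_prod_closed] by blast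
  interpret g: linear_map K F X g by fact
  have "tensor_relators K V W \<subseteq> g.ker"
    by (auto simp: tensor_relators_def Let_def g.ker_def V.free_gen_closed g_gen
        b.add_left b.add_right b.smult_left b.smult_right)
  then have "N \<subseteq> g.ker"
    unfolding tensor_null_def using g.ker_is_submodule by (rule F.span_is_subset)
  then have "\<And>f. f \<in> N \<Longrightarrow> g f = \<zero>\<^bsub>X\<^esub>"
    by (auto simp: g.ker_def)
  then obtain f where f: "linear_map K T X f" "\<And>v. v \<in> carrier F \<Longrightarrow> f (N +>\<^bsub>F\<^esub> v) = g v"
    using F.quotient_space_lift[OF null_submodule g] unfolding tensor_space_def by blast
  have "f (t x y) = b x y" if "x \<in> carrier V" "y \<in> carrier W" for x y
    using that by (simp add: pure_tensor_def f(2) V.free_gen_closed g_gen)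
  with f(1) show thesis by (rule that)
qed

end

text \<open>
  The next two rules reduce an identity that is additive in two or three variables to pure tensors.
\<close>

lemma (in tensor_product) tensor_induct2 [consumes 2, case_names pure add1 add2]:
  assumes uv: "u \<in> carrier T" "v \<in> carrier T"
    and pure: "\<And>x\<^sub>1 x\<^sub>2 y\<^sub>1 y\<^sub>2. \<lbrakk>x\<^sub>1 \<in> carrier V; x\<^sub>2 \<in> carrier W; y\<^sub>1 \<in> carrier V; y\<^sub>2 \<in> carrier W\<rbrakk>
      \<Longrightarrow> P (t x\<^sub>1 x\<^sub>2) (t y\<^sub>1 y\<^sub>2)"
    and add1: "\<And>u u' v. \<lbrakk>u \<in> carrier T; u' \<in> carrier T; v \<in> carrier T; P u v; P u' v\<rbrakk>
      \<Longrightarrow> P (u \<oplus>\<^bsub>T\<^esub> u') v"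
    and add2: "\<And>u v v'. \<lbrakk>u \<in> carrier T; v \<in> carrier T; v' \<in> carrier T; P u v; P u v'\<rbrakk>
      \<Longrightarrow> P u (v \<oplus>\<^bsub>T\<^esub> v')"
  shows "P u v"
  using uv
proof (induction u rule: tensor_induct)
  case (pure x y)
  from pure.prems show ?case
    by (induction v rule: tensor_induct) (use pure.hyps in \<open>simp_all add: assms(3) add2\<close>)
qed (simp add: add1)

lemma (in tensor_product) tensor_induct3 [consumes 3, case_names pure add1 add2 add3]:
  assumes uvw: "u \<in> carrier T" "v \<in> carrier T" "w \<in> carrier T"
    and pure: "\<And>x\<^sub>1 x\<^sub>2 y\<^sub>1 y\<^sub>2 z\<^sub>1 z\<^sub>2. \<lbrakk>x\<^sub>1 \<in> carrier V; x\<^sub>2 \<in> carrier W; y\<^sub>1 \<in> carrier V; y\<^sub>2 \<in> carrier W;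
      z\<^sub>1 \<in> carrier V; z\<^sub>2 \<in> carrier W\<rbrakk> \<Longrightarrow> P (t x\<^sub>1 x\<^sub>2) (t y\<^sub>1 y\<^sub>2) (t z\<^sub>1 z\<^sub>2)"
    and add1: "\<And>u u' v w. \<lbrakk>u \<in> carrier T; u' \<in> carrier T; v \<in> carrier T; w \<in> carrier T;
      P u v w; P u' v w\<rbrakk> \<Longrightarrow> P (u \<oplus>\<^bsub>T\<^esub> u') v w"
    and add2: "\<And>u v v' w. \<lbrakk>u \<in> carrier T; v \<in> carrier T; v' \<in> carrier T; w \<in> carrier T;
      P u v w; P u v' w\<rbrakk> \<Longrightarrow> P u (v \<oplus>\<^bsub>T\<^esub> v') w"
    and add3: "\<And>u v w w'. \<lbrakk>u \<in> carrier T; v \<in> carrier T; w \<in> carrier T; w' \<in> carrier T;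
      P u v w; P u v w'\<rbrakk> \<Longrightarrow> P u v (w \<oplus>\<^bsub>T\<^esub> w')"
  shows "P u v w"
  using uvw
proof (induction u rule: tensor_induct)
  case (pure x y)
  from pure.prems show ?case
    by (induction rule: tensor_induct2) (use pure.hyps in \<open>simp_all add: assms(4) add2 add3\<close>)
qed (simp add: add1)

section \<open>Induced maps on tensor products\<close>

lemma tensor_product_linear_maps:
  assumes f: "linear_map K V V' f" and g: "linear_map K W W' g"
  obtains h where "linear_map K (tensor_space K V W) (tensor_space K V' W') h"
    and "\<And>x y. \<lbrakk>x \<in> carrier V; y \<in> carrier W\<rbrakk>
      \<Longrightarrow> h (pure_tensor K V W x y) = pure_tensor K V' W' (f x) (g y)"
proof -
  interpret f: linear_map K V V' f by fact
  interpret g: linear_map K W W' g by fact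
  interpret A: tensor_product K V W ..
  interpret A': tensor_product K V' W' ..
  show thesis
    using A.tensor_lift[OF A'.pure.comp_linear[OF f g]] that by blast
qed

text \<open>
  The induced bilinear map arises by using the universal property twice. For fixed \<open>x'\<close> and \<open>y'\<close>, the
  linear maps \<open>b\<^sub>1(-, x')\<close> and \<open>b\<^sub>2(-, y')\<close> induce a linear map \<open>L x' y'\<close> on \<open>V \<otimes> W\<close>. For fixed \<open>u\<close>, the
  value \<open>L x' y' u\<close> is bilinear in \<open>x'\<close> and \<open>y'\<close> and thus induces a linear map \<open>b u\<close> on \<open>V' \<otimes> W'\<close>. At both
  stages, linearity in the other variable is an equation between linear maps, which is checked on pure
  tensors.
\<close>

lemma tensor_product_bilinear_maps:
  assumes b1: "bilinear_map K V V' V'' b\<^sub>1" and b2: "bilinear_map K W W' W'' b\<^sub>2"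
  obtains b
  where "bilinear_map K (tensor_space K V W) (tensor_space K V' W') (tensor_space K V'' W'') b"
    and "\<And>x y x' y'. \<lbrakk>x \<in> carrier V; y \<in> carrier W; x' \<in> carrier V'; y' \<in> carrier W'\<rbrakk>
      \<Longrightarrow> b (pure_tensor K V W x y) (pure_tensor K V' W' x' y')
        = pure_tensor K V'' W'' (b\<^sub>1 x x') (b\<^sub>2 y y')"
proof -
  interpret b1: bilinear_map K V V' V'' b\<^sub>1 by fact
  interpret b2: bilinear_map K W W' W'' b\<^sub>2 by fact
  interpret A: tensor_product K V W ..
  interpret A': tensor_product K V' W' ..
  interpret A'': tensor_product K V'' W'' ..
  have "\<exists>h. linear_map K A.T A''.T h \<and>
      (\<forall>x\<in>carrier V. \<forall>y\<in>carrier W. h (A.t x y) = A''.t (b\<^sub>1 x x') (b\<^sub>2 y y'))"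
    if "x' \<in> carrier V'" "y' \<in> carrier W'" for x' y'
    using tensor_product_linear_maps[OF b1.linear_left[OF that(1)] b2.linear_left[OF that(2)]]
    by metis
  then obtain L where L: "\<And>x' y'. \<lbrakk>x' \<in> carrier V'; y' \<in> carrier W'\<rbrakk> \<Longrightarrow> linear_map K A.T A''.T (L x' y')"
    and L_pure: "\<And>x y x' y'. \<lbrakk>x \<in> carrier V; y \<in> carrier W; x' \<in> carrier V'; y' \<in> carrier W'\<rbrakk>
      \<Longrightarrow> L x' y' (A.t x y) = A''.t (b\<^sub>1 x x') (b\<^sub>2 y y')"
    by metis
  have L_closed: "L x' y' u \<in> carrier A''.T"
    if "x' \<in> carrier V'" "y' \<in> carrier W'" "u \<in> carrier A.T" for x' y' u
  proof -
    interpret L: linear_map K A.T A''.T "L x' y'" using that(1,2) by (rule L)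
    show ?thesis using that(3) by (rule L.f_im)
  qed
  have L_bilinear: "bilinear_map K V' W' A''.T (\<lambda>x' y'. L x' y' u)" if u: "u \<in> carrier A.T" for u
  proof (rule bilinear_mapI)
    fix x' assume x': "x' \<in> carrier V'"
    show "linear_map K W' A''.T (\<lambda>y'. L x' y' u)"
    proof (rule linear_mapI)
      fix y z assume yz: "y \<in> carrier W'" "z \<in> carrier W'"
      show "L x' (y \<oplus>\<^bsub>W'\<^esub> z) u = L x' y u \<oplus>\<^bsub>A''.T\<^esub> L x' z u"
        using x' yz by (intro A.linear_map_eqI[OF L linear_map_add[OF L L] _ u])
          (auto simp: L_pure b2.add_right A''.pure.add_right)
    next
      fix c y assume cy: "c \<in> carrier K" "y \<in> carrier W'"
      show "L x' (c \<odot>\<^bsub>W'\<^esub> y) u = c \<odot>\<^bsub>A''.T\<^esub> L x' y u"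
        using x' cy by (intro A.linear_map_eqI[OF L linear_map_smult[OF L] _ u])
          (auto simp: L_pure b2.smult_right A''.pure.smult_right)
    qed (use x' u in \<open>auto simp: L_closed b2.W.vectorspace_axioms A''.T.vectorspace_axioms\<close>)
  next
    fix y' assume y': "y' \<in> carrier W'"
    show "linear_map K V' A''.T (\<lambda>x'. L x' y' u)"
    proof (rule linear_mapI)
      fix x z assume xz: "x \<in> carrier V'" "z \<in> carrier V'"
      show "L (x \<oplus>\<^bsub>V'\<^esub> z) y' u = L x y' u \<oplus>\<^bsub>A''.T\<^esub> L z y' u"
        using y' xz by (intro A.linear_map_eqI[OF L linear_map_add[OF L L] _ u])
          (auto simp: L_pure b1.add_right A''.pure.add_left)
    next
      fix c x assume cx: "c \<in> carrier K" "x \<in> carrier V'"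
      show "L (c \<odot>\<^bsub>V'\<^esub> x) y' u = c \<odot>\<^bsub>A''.T\<^esub> L x y' u"
        using y' cx by (intro A.linear_map_eqI[OF L linear_map_smult[OF L] _ u])
          (auto simp: L_pure b1.smult_right A''.pure.smult_left)
    qed (use y' u in \<open>auto simp: L_closed b1.W.vectorspace_axioms A''.T.vectorspace_axioms\<close>)
  qed unfold_locales
  have "\<exists>h. linear_map K A'.T A''.T h \<and>
      (\<forall>x'\<in>carrier V'. \<forall>y'\<in>carrier W'. h (A'.t x' y') = L x' y' u)" if "u \<in> carrier A.T" for u
    using A'.tensor_lift[OF L_bilinear[OF that]] by metis
  then obtain b where b: "\<And>u. u \<in> carrier A.T \<Longrightarrow> linear_map K A'.T A''.T (b u)"
    and b_pure: "\<And>u x' y'. \<lbrakk>u \<in> carrier A.T; x' \<in> carrier V'; y' \<in> carrier W'\<rbrakk>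
      \<Longrightarrow> b u (A'.t x' y') = L x' y' u"
    by metis
  have b_closed: "b u v \<in> carrier A''.T" if "u \<in> carrier A.T" "v \<in> carrier A'.T" for u v
  proof -
    interpret b: linear_map K A'.T A''.T "b u" using that(1) by (rule b)
    show ?thesis using that(2) by (rule b.f_im)
  qed
  have "bilinear_map K A.T A'.T A''.T b"
  proof (rule bilinear_mapI)
    fix v assume v: "v \<in> carrier A'.T"
    show "linear_map K A.T A''.T (\<lambda>u. b u v)"
    proof (rule linear_mapI)
      fix u w assume uw: "u \<in> carrier A.T" "w \<in> carrier A.T"
      have "L x' y' (u \<oplus>\<^bsub>A.T\<^esub> w) = L x' y' u \<oplus>\<^bsub>A''.T\<^esub> L x' y' w"
        if "x' \<in> carrier V'" "y' \<in> carrier W'" for x' y'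
      proof -
        interpret L: linear_map K A.T A''.T "L x' y'" using that by (rule L)
        show ?thesis using uw by (rule L.f_add)
      qed
      then show "b (u \<oplus>\<^bsub>A.T\<^esub> w) v = b u v \<oplus>\<^bsub>A''.T\<^esub> b w v"
        using uw by (intro A'.linear_map_eqI[OF b linear_map_add[OF b b] _ v])
          (auto simp: b_pure)
    next
      fix c u assume cu: "c \<in> carrier K" "u \<in> carrier A.T"
      have "L x' y' (c \<odot>\<^bsub>A.T\<^esub> u) = c \<odot>\<^bsub>A''.T\<^esub> L x' y' u"
        if "x' \<in> carrier V'" "y' \<in> carrier W'" for x' y'
      proof -
        interpret L: linear_map K A.T A''.T "L x' y'" using that by (rule L)
        show ?thesis using cu by (rule L.f_smult)
      qed
      then show "b (c \<odot>\<^bsub>A.T\<^esub> u) v = c \<odot>\<^bsub>A''.T\<^esub> b u v"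
        using cu by (intro A'.linear_map_eqI[OF b linear_map_smult[OF b] _ v])
          (auto simp: b_pure)
    qed (use v in \<open>auto simp: b_closed A.T.vectorspace_axioms A''.T.vectorspace_axioms\<close>)
  qed (rule A.T.vectorspace_axioms A'.T.vectorspace_axioms A''.T.vectorspace_axioms | erule b)+
  moreover have "b (A.t x y) (A'.t x' y') = A''.t (b\<^sub>1 x x') (b\<^sub>2 y y')"
    if "x \<in> carrier V" "y \<in> carrier W" "x' \<in> carrier V'" "y' \<in> carrier W'" for x y x' y'
    using that by (simp add: b_pure L_pure)
  ultimately show thesis by (rule that)
qed

section \<open>Consequences of the axioms\<close>

lemma (in abelian_group) minus_add_add:
  assumes "a \<in> carrier G" "b \<in> carrier G" "c \<in> carrier G" "d \<in> carrier G"
  shows "(a \<oplus> b) \<ominus> (c \<oplus> d) = (a \<ominus> c) \<oplus> (b \<ominus> d)"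
  using assms by (simp add: a_minus_def minus_add a_ac)

context hom_algebra
begin

lemma mul_bilinear: "bilinear_map K A A A mul"
  by (intro bilinear_mapI vectorspace_axioms mul_linear_right mul_linear_left)

lemma mul_closed [simp]: "\<lbrakk>x \<in> carrier A; y \<in> carrier A\<rbrakk> \<Longrightarrow> mul x y \<in> carrier A"
  by (rule bilinear_map.closed[OF mul_bilinear])

lemma mul_add_left:
  "\<lbrakk>x \<in> carrier A; x' \<in> carrier A; y \<in> carrier A\<rbrakk> \<Longrightarrow> mul (x \<oplus> x') y = mul x y \<oplus> mul x' y"
  by (rule bilinear_map.add_left[OF mul_bilinear])

lemma mul_add_right:
  "\<lbrakk>x \<in> carrier A; y \<in> carrier A; y' \<in> carrier A\<rbrakk> \<Longrightarrow> mul x (y \<oplus> y') = mul x y \<oplus> mul x y'"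
  by (rule bilinear_map.add_right[OF mul_bilinear])

interpretation twist: linear_map K A A \<alpha> by (rule twist_linear)

lemma twist_closed [simp]: "x \<in> carrier A \<Longrightarrow> \<alpha> x \<in> carrier A"
  by (rule twist.f_im)

lemma twist_add: "\<lbrakk>x \<in> carrier A; y \<in> carrier A\<rbrakk> \<Longrightarrow> \<alpha> (x \<oplus> y) = \<alpha> x \<oplus> \<alpha> y"
  by (rule twist.f_add)

end

lemma (in commutative_hom_associative_algebra) dot_right_commute:
  assumes "x \<in> carrier A" "y \<in> carrier A" "z \<in> carrier A"
  shows "(x \<bullet> y) \<bullet> \<alpha> z = (x \<bullet> z) \<bullet> \<alpha> y"
  using assms by (simp add: hom_associative dot_commute[of y z])

text \<open>
  With this form of the second compatibility condition, the mixed terms \<open>\<alpha> x \<bullet> (y \<star> z)\<close> of an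
  expansion become symmetric in \<open>x\<close> and \<open>y\<close>.
\<close>

lemma (in hom_novikov_poisson_algebra) twist_dot_star:
  assumes "x \<in> carrier A" "y \<in> carrier A" "z \<in> carrier A"
  shows "\<alpha> x \<bullet> (y \<star> z) = (x \<bullet> y) \<star> \<alpha> z"
  using assms dot_star_compat[of y x z] by (simp add: dot_commute)

section \<open>The identities on the tensor product\<close>

text \<open>
  The operations on the tensor product are only assumed to take the prescribed values on pure tensors;
  that such operations exist is shown separately.
\<close>

locale tensor_double_hom_algebra =
  tensor_product K A\<^sub>1 A\<^sub>2 +
  H\<^sub>1: double_hom_algebra K A\<^sub>1 dot\<^sub>1 star\<^sub>1 \<alpha>\<^sub>1 +
  H\<^sub>2: double_hom_algebra K A\<^sub>2 dot\<^sub>2 star\<^sub>2 \<alpha>\<^sub>2 +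
  A: double_hom_algebra K "tensor_space K A\<^sub>1 A\<^sub>2" dot star \<alpha>
  for K :: "('k, 'r) ring_scheme"
    and A\<^sub>1 :: "('k, 'a, 'm) module_scheme"
    and dot\<^sub>1 (infixl \<open>\<bullet>\<^sub>1\<close> 70) and star\<^sub>1 (infixl \<open>\<star>\<^sub>1\<close> 70) and \<alpha>\<^sub>1
    and A\<^sub>2 :: "('k, 'b, 'n) module_scheme"
    and dot\<^sub>2 (infixl \<open>\<bullet>\<^sub>2\<close> 70) and star\<^sub>2 (infixl \<open>\<star>\<^sub>2\<close> 70) and \<alpha>\<^sub>2
    and dot (infixl \<open>\<bullet>\<close> 70) and star (infixl \<open>\<star>\<close> 70) and \<alpha> +
  assumes twist_pure: "\<lbrakk>x\<^sub>1 \<in> carrier A\<^sub>1; x\<^sub>2 \<in> carrier A\<^sub>2\<rbrakk> \<Longrightarrow> \<alpha> (t x\<^sub>1 x\<^sub>2) = t (\<alpha>\<^sub>1 x\<^sub>1) (\<alpha>\<^sub>2 x\<^sub>2)"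
    and dot_pure: "\<lbrakk>x\<^sub>1 \<in> carrier A\<^sub>1; x\<^sub>2 \<in> carrier A\<^sub>2; y\<^sub>1 \<in> carrier A\<^sub>1; y\<^sub>2 \<in> carrier A\<^sub>2\<rbrakk>
      \<Longrightarrow> t x\<^sub>1 x\<^sub>2 \<bullet> t y\<^sub>1 y\<^sub>2 = t (x\<^sub>1 \<bullet>\<^sub>1 y\<^sub>1) (x\<^sub>2 \<bullet>\<^sub>2 y\<^sub>2)"
    and star_pure: "\<lbrakk>x\<^sub>1 \<in> carrier A\<^sub>1; x\<^sub>2 \<in> carrier A\<^sub>2; y\<^sub>1 \<in> carrier A\<^sub>1; y\<^sub>2 \<in> carrier A\<^sub>2\<rbrakk>
      \<Longrightarrow> t x\<^sub>1 x\<^sub>2 \<star> t y\<^sub>1 y\<^sub>2 = t (x\<^sub>1 \<star>\<^sub>1 y\<^sub>1) (x\<^sub>2 \<bullet>\<^sub>2 y\<^sub>2) \<oplus>\<^bsub>T\<^esub> t (x\<^sub>1 \<bullet>\<^sub>1 y\<^sub>1) (x\<^sub>2 \<star>\<^sub>2 y\<^sub>2)"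
begin

lemmas add_simps =
  A.dot.mul_add_left A.dot.mul_add_right A.star.mul_add_left A.star.mul_add_right A.dot.twist_add

lemmas pure_simps = twist_pure dot_pure star_pure

lemma multiplicative:
  assumes "multiplicative_double_hom_algebra K A\<^sub>1 dot\<^sub>1 star\<^sub>1 \<alpha>\<^sub>1"
    and "multiplicative_double_hom_algebra K A\<^sub>2 dot\<^sub>2 star\<^sub>2 \<alpha>\<^sub>2"
  shows "multiplicative_double_hom_algebra K T dot star \<alpha>"
proof -
  interpret M\<^sub>1: multiplicative_double_hom_algebra K A\<^sub>1 dot\<^sub>1 star\<^sub>1 \<alpha>\<^sub>1 by fact
  interpret M\<^sub>2: multiplicative_double_hom_algebra K A\<^sub>2 dot\<^sub>2 star\<^sub>2 \<alpha>\<^sub>2 by fact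
  show ?thesis
  proof
    fix u v assume "u \<in> carrier T" "v \<in> carrier T"
    then show "\<alpha> (u \<bullet> v) = \<alpha> u \<bullet> \<alpha> v"
    proof (induction rule: tensor_induct2)
      case pure
      then show ?case by (simp add: pure_simps M\<^sub>1.twist_dot M\<^sub>2.twist_dot)
    qed (simp_all add: add_simps)
  next
    fix u v assume "u \<in> carrier T" "v \<in> carrier T"
    then show "\<alpha> (u \<star> v) = \<alpha> u \<star> \<alpha> v"
    proof (induction rule: tensor_induct2)
      case pure
      then show ?case
        by (simp add: pure_simps add_simps M\<^sub>1.twist_dot M\<^sub>2.twist_dot M\<^sub>1.twist_star M\<^sub>2.twist_star)
    qed (simp_all add: add_simps)
  qed
qed

end

locale tensor_hom_novikov_poisson_algebra =
  tensor_double_hom_algebra +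
  N\<^sub>1: hom_novikov_poisson_algebra K A\<^sub>1 dot\<^sub>1 star\<^sub>1 \<alpha>\<^sub>1 +
  N\<^sub>2: hom_novikov_poisson_algebra K A\<^sub>2 dot\<^sub>2 star\<^sub>2 \<alpha>\<^sub>2
begin

context
  fixes x\<^sub>1 y\<^sub>1 z\<^sub>1 x\<^sub>2 y\<^sub>2 z\<^sub>2
  assumes carr: "x\<^sub>1 \<in> carrier A\<^sub>1" "y\<^sub>1 \<in> carrier A\<^sub>1" "z\<^sub>1 \<in> carrier A\<^sub>1"
    "x\<^sub>2 \<in> carrier A\<^sub>2" "y\<^sub>2 \<in> carrier A\<^sub>2" "z\<^sub>2 \<in> carrier A\<^sub>2"
begin

text \<open>
  Both double products expand into four terms. The second and third terms of the two expansions have to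
  be paired crosswise for the differences to share a factor.
\<close>

lemma star_associator_pure:
  "(t x\<^sub>1 x\<^sub>2 \<star> t y\<^sub>1 y\<^sub>2) \<star> \<alpha> (t z\<^sub>1 z\<^sub>2) \<ominus>\<^bsub>T\<^esub> \<alpha> (t x\<^sub>1 x\<^sub>2) \<star> (t y\<^sub>1 y\<^sub>2 \<star> t z\<^sub>1 z\<^sub>2)
   = (t ((x\<^sub>1 \<star>\<^sub>1 y\<^sub>1) \<star>\<^sub>1 \<alpha>\<^sub>1 z\<^sub>1 \<ominus>\<^bsub>A\<^sub>1\<^esub> \<alpha>\<^sub>1 x\<^sub>1 \<star>\<^sub>1 (y\<^sub>1 \<star>\<^sub>1 z\<^sub>1)) ((x\<^sub>2 \<bullet>\<^sub>2 y\<^sub>2) \<bullet>\<^sub>2 \<alpha>\<^sub>2 z\<^sub>2)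
   \<oplus>\<^bsub>T\<^esub> t ((x\<^sub>1 \<star>\<^sub>1 y\<^sub>1) \<bullet>\<^sub>1 \<alpha>\<^sub>1 z\<^sub>1 \<ominus>\<^bsub>A\<^sub>1\<^esub> \<alpha>\<^sub>1 x\<^sub>1 \<star>\<^sub>1 (y\<^sub>1 \<bullet>\<^sub>1 z\<^sub>1)) ((x\<^sub>2 \<bullet>\<^sub>2 y\<^sub>2) \<star>\<^sub>2 \<alpha>\<^sub>2 z\<^sub>2))
   \<oplus>\<^bsub>T\<^esub> (t ((x\<^sub>1 \<bullet>\<^sub>1 y\<^sub>1) \<star>\<^sub>1 \<alpha>\<^sub>1 z\<^sub>1) ((x\<^sub>2 \<star>\<^sub>2 y\<^sub>2) \<bullet>\<^sub>2 \<alpha>\<^sub>2 z\<^sub>2 \<ominus>\<^bsub>A\<^sub>2\<^esub> \<alpha>\<^sub>2 x\<^sub>2 \<star>\<^sub>2 (y\<^sub>2 \<bullet>\<^sub>2 z\<^sub>2))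
   \<oplus>\<^bsub>T\<^esub> t ((x\<^sub>1 \<bullet>\<^sub>1 y\<^sub>1) \<bullet>\<^sub>1 \<alpha>\<^sub>1 z\<^sub>1) ((x\<^sub>2 \<star>\<^sub>2 y\<^sub>2) \<star>\<^sub>2 \<alpha>\<^sub>2 z\<^sub>2 \<ominus>\<^bsub>A\<^sub>2\<^esub> \<alpha>\<^sub>2 x\<^sub>2 \<star>\<^sub>2 (y\<^sub>2 \<star>\<^sub>2 z\<^sub>2)))"
  (is "?l \<ominus>\<^bsub>T\<^esub> ?r = _")
proof -
  define a b c d where abcd:
    "a = t ((x\<^sub>1 \<star>\<^sub>1 y\<^sub>1) \<star>\<^sub>1 \<alpha>\<^sub>1 z\<^sub>1) ((x\<^sub>2 \<bullet>\<^sub>2 y\<^sub>2) \<bullet>\<^sub>2 \<alpha>\<^sub>2 z\<^sub>2)"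
    "b = t ((x\<^sub>1 \<star>\<^sub>1 y\<^sub>1) \<bullet>\<^sub>1 \<alpha>\<^sub>1 z\<^sub>1) ((x\<^sub>2 \<bullet>\<^sub>2 y\<^sub>2) \<star>\<^sub>2 \<alpha>\<^sub>2 z\<^sub>2)"
    "c = t ((x\<^sub>1 \<bullet>\<^sub>1 y\<^sub>1) \<star>\<^sub>1 \<alpha>\<^sub>1 z\<^sub>1) ((x\<^sub>2 \<star>\<^sub>2 y\<^sub>2) \<bullet>\<^sub>2 \<alpha>\<^sub>2 z\<^sub>2)"
    "d = t ((x\<^sub>1 \<bullet>\<^sub>1 y\<^sub>1) \<bullet>\<^sub>1 \<alpha>\<^sub>1 z\<^sub>1) ((x\<^sub>2 \<star>\<^sub>2 y\<^sub>2) \<star>\<^sub>2 \<alpha>\<^sub>2 z\<^sub>2)"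
  define a' b' c' d' where abcd':
    "a' = t (\<alpha>\<^sub>1 x\<^sub>1 \<star>\<^sub>1 (y\<^sub>1 \<star>\<^sub>1 z\<^sub>1)) ((x\<^sub>2 \<bullet>\<^sub>2 y\<^sub>2) \<bullet>\<^sub>2 \<alpha>\<^sub>2 z\<^sub>2)"
    "b' = t (\<alpha>\<^sub>1 x\<^sub>1 \<star>\<^sub>1 (y\<^sub>1 \<bullet>\<^sub>1 z\<^sub>1)) ((x\<^sub>2 \<bullet>\<^sub>2 y\<^sub>2) \<star>\<^sub>2 \<alpha>\<^sub>2 z\<^sub>2)"
    "c' = t ((x\<^sub>1 \<bullet>\<^sub>1 y\<^sub>1) \<star>\<^sub>1 \<alpha>\<^sub>1 z\<^sub>1) (\<alpha>\<^sub>2 x\<^sub>2 \<star>\<^sub>2 (y\<^sub>2 \<bullet>\<^sub>2 z\<^sub>2))"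
    "d' = t ((x\<^sub>1 \<bullet>\<^sub>1 y\<^sub>1) \<bullet>\<^sub>1 \<alpha>\<^sub>1 z\<^sub>1) (\<alpha>\<^sub>2 x\<^sub>2 \<star>\<^sub>2 (y\<^sub>2 \<star>\<^sub>2 z\<^sub>2))"
  have closed: "a \<in> carrier T" "b \<in> carrier T" "c \<in> carrier T" "d \<in> carrier T"
      "a' \<in> carrier T" "b' \<in> carrier T" "c' \<in> carrier T" "d' \<in> carrier T"
    using carr by (simp_all add: abcd abcd')
  have "?l = (a \<oplus>\<^bsub>T\<^esub> b) \<oplus>\<^bsub>T\<^esub> (c \<oplus>\<^bsub>T\<^esub> d)"
    using carr by (simp add: pure_simps add_simps abcd)
  moreover have "?r = (a' \<oplus>\<^bsub>T\<^esub> c') \<oplus>\<^bsub>T\<^esub> (b' \<oplus>\<^bsub>T\<^esub> d')"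
    using carr by (simp add: pure_simps add_simps abcd' N\<^sub>1.twist_dot_star N\<^sub>2.twist_dot_star
        flip: N\<^sub>1.hom_associative N\<^sub>2.hom_associative)
  moreover have "(a \<oplus>\<^bsub>T\<^esub> b) \<oplus>\<^bsub>T\<^esub> (c \<oplus>\<^bsub>T\<^esub> d) \<ominus>\<^bsub>T\<^esub> ((a' \<oplus>\<^bsub>T\<^esub> c') \<oplus>\<^bsub>T\<^esub> (b' \<oplus>\<^bsub>T\<^esub> d'))
      = ((a \<ominus>\<^bsub>T\<^esub> a') \<oplus>\<^bsub>T\<^esub> (b \<ominus>\<^bsub>T\<^esub> b')) \<oplus>\<^bsub>T\<^esub> ((c \<ominus>\<^bsub>T\<^esub> c') \<oplus>\<^bsub>T\<^esub> (d \<ominus>\<^bsub>T\<^esub> d'))"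
    using closed by (simp add: a_minus_def T.M.minus_add T.M.a_ac)
  ultimately show ?thesis
    using carr by (simp add: pure.minus_left pure.minus_right abcd abcd')
qed

text \<open>
  Both products expand into two terms, and Hom-associativity makes the terms agree in one factor.
\<close>

lemma star_dot_associator_pure:
  "(t x\<^sub>1 x\<^sub>2 \<star> t y\<^sub>1 y\<^sub>2) \<bullet> \<alpha> (t z\<^sub>1 z\<^sub>2) \<ominus>\<^bsub>T\<^esub> \<alpha> (t x\<^sub>1 x\<^sub>2) \<star> (t y\<^sub>1 y\<^sub>2 \<bullet> t z\<^sub>1 z\<^sub>2)
   = t ((x\<^sub>1 \<star>\<^sub>1 y\<^sub>1) \<bullet>\<^sub>1 \<alpha>\<^sub>1 z\<^sub>1 \<ominus>\<^bsub>A\<^sub>1\<^esub> \<alpha>\<^sub>1 x\<^sub>1 \<star>\<^sub>1 (y\<^sub>1 \<bullet>\<^sub>1 z\<^sub>1)) ((x\<^sub>2 \<bullet>\<^sub>2 y\<^sub>2) \<bullet>\<^sub>2 \<alpha>\<^sub>2 z\<^sub>2)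
   \<oplus>\<^bsub>T\<^esub> t ((x\<^sub>1 \<bullet>\<^sub>1 y\<^sub>1) \<bullet>\<^sub>1 \<alpha>\<^sub>1 z\<^sub>1) ((x\<^sub>2 \<star>\<^sub>2 y\<^sub>2) \<bullet>\<^sub>2 \<alpha>\<^sub>2 z\<^sub>2 \<ominus>\<^bsub>A\<^sub>2\<^esub> \<alpha>\<^sub>2 x\<^sub>2 \<star>\<^sub>2 (y\<^sub>2 \<bullet>\<^sub>2 z\<^sub>2))"
  using carr by (simp add: pure_simps add_simps pure.minus_left pure.minus_right T.M.minus_add_add
      flip: N\<^sub>1.hom_associative N\<^sub>2.hom_associative)

end

lemma hom_novikov_poisson: "hom_novikov_poisson_algebra K T dot star \<alpha>"
proof
  fix u v assume "u \<in> carrier T" "v \<in> carrier T"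
  then show "u \<bullet> v = v \<bullet> u"
  proof (induction rule: tensor_induct2)
    case (pure x\<^sub>1 x\<^sub>2 y\<^sub>1 y\<^sub>2)
    then show ?case
      by (simp add: pure_simps N\<^sub>1.dot_commute[of x\<^sub>1 y\<^sub>1] N\<^sub>2.dot_commute[of x\<^sub>2 y\<^sub>2])
  qed (simp_all add: add_simps)
next
  fix u v w assume "u \<in> carrier T" "v \<in> carrier T" "w \<in> carrier T"
  then show "(u \<bullet> v) \<bullet> \<alpha> w = \<alpha> u \<bullet> (v \<bullet> w)"
  proof (induction rule: tensor_induct3)
    case pure
    then show ?case by (simp add: pure_simps N\<^sub>1.hom_associative N\<^sub>2.hom_associative)
  qed (simp_all add: add_simps)
next
  fix u v w assume "u \<in> carrier T" "v \<in> carrier T" "w \<in> carrier T"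
  then show "(u \<star> v) \<star> \<alpha> w \<ominus>\<^bsub>T\<^esub> \<alpha> u \<star> (v \<star> w) = (v \<star> u) \<star> \<alpha> w \<ominus>\<^bsub>T\<^esub> \<alpha> v \<star> (u \<star> w)"
  proof (induction rule: tensor_induct3)
    case (pure x\<^sub>1 x\<^sub>2 y\<^sub>1 y\<^sub>2 z\<^sub>1 z\<^sub>2)
    then show ?case
      by (simp only: star_associator_pure N\<^sub>1.hom_left_symmetric[of x\<^sub>1 y\<^sub>1 z\<^sub>1]
          N\<^sub>2.hom_left_symmetric[of x\<^sub>2 y\<^sub>2 z\<^sub>2] N\<^sub>1.star_dot_compat[of x\<^sub>1 y\<^sub>1 z\<^sub>1]
          N\<^sub>2.star_dot_compat[of x\<^sub>2 y\<^sub>2 z\<^sub>2] N\<^sub>1.dot_commute[of x\<^sub>1 y\<^sub>1] N\<^sub>2.dot_commute[of x\<^sub>2 y\<^sub>2])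
  qed (simp_all add: add_simps T.M.minus_add_add)
next
  fix u v w assume "u \<in> carrier T" "v \<in> carrier T" "w \<in> carrier T"
  then show "(u \<star> v) \<star> \<alpha> w = (u \<star> w) \<star> \<alpha> v"
  proof (induction rule: tensor_induct3)
    case (pure x\<^sub>1 x\<^sub>2 y\<^sub>1 y\<^sub>2 z\<^sub>1 z\<^sub>2)
    \<comment> \<open>The compatibility condition turns \<open>(x \<bullet> y) \<star> \<alpha> z\<close> into \<open>(x \<star> z) \<bullet> \<alpha> y\<close>, which identifies each mixed
      term on the left with the other mixed term on the right.\<close>
    then show ?case
      by (simp add: pure_simps add_simps N\<^sub>1.dot_star_compat N\<^sub>2.dot_star_compat
          N\<^sub>1.hom_right_commute[of x\<^sub>1 y\<^sub>1 z\<^sub>1] N\<^sub>2.hom_right_commute[of x\<^sub>2 y\<^sub>2 z\<^sub>2]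
          N\<^sub>1.dot_right_commute[of x\<^sub>1 y\<^sub>1 z\<^sub>1] N\<^sub>2.dot_right_commute[of x\<^sub>2 y\<^sub>2 z\<^sub>2] T.M.a_ac)
  qed (simp_all add: add_simps)
next
  fix u v w assume "u \<in> carrier T" "v \<in> carrier T" "w \<in> carrier T"
  then show "(u \<star> v) \<bullet> \<alpha> w \<ominus>\<^bsub>T\<^esub> \<alpha> u \<star> (v \<bullet> w) = (v \<star> u) \<bullet> \<alpha> w \<ominus>\<^bsub>T\<^esub> \<alpha> v \<star> (u \<bullet> w)"
  proof (induction rule: tensor_induct3)
    case (pure x\<^sub>1 x\<^sub>2 y\<^sub>1 y\<^sub>2 z\<^sub>1 z\<^sub>2)
    then show ?case
      by (simp only: star_dot_associator_pure N\<^sub>1.star_dot_compat[of x\<^sub>1 y\<^sub>1 z\<^sub>1]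
          N\<^sub>2.star_dot_compat[of x\<^sub>2 y\<^sub>2 z\<^sub>2] N\<^sub>1.dot_commute[of x\<^sub>1 y\<^sub>1] N\<^sub>2.dot_commute[of x\<^sub>2 y\<^sub>2])
  qed (simp_all add: add_simps T.M.minus_add_add)
next
  fix u v w assume "u \<in> carrier T" "v \<in> carrier T" "w \<in> carrier T"
  then show "(u \<bullet> v) \<star> \<alpha> w = (u \<star> w) \<bullet> \<alpha> v"
  proof (induction rule: tensor_induct3)
    case (pure x\<^sub>1 x\<^sub>2 y\<^sub>1 y\<^sub>2 z\<^sub>1 z\<^sub>2)
    then show ?case
      by (simp add: pure_simps add_simps N\<^sub>1.dot_star_compat N\<^sub>2.dot_star_compat
          N\<^sub>1.dot_right_commute[of x\<^sub>1 y\<^sub>1 z\<^sub>1] N\<^sub>2.dot_right_commute[of x\<^sub>2 y\<^sub>2 z\<^sub>2])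
  qed (simp_all add: add_simps)
qed

end

section \<open>Existence of the operations\<close>

lemma double_hom_algebraI:
  assumes "vectorspace K A" "linear_map K A A \<alpha>" "bilinear_map K A A A dot" "bilinear_map K A A A star"
  shows "double_hom_algebra K A dot star \<alpha>"
  using assms
  by (intro double_hom_algebra.intro hom_algebra.intro hom_algebra_axioms.intro)
    (auto intro: bilinear_map.linear_right bilinear_map.linear_left)

lemma tensor_double_hom_algebra_exists:
  assumes "double_hom_algebra K A\<^sub>1 dot\<^sub>1 star\<^sub>1 \<alpha>\<^sub>1" and "double_hom_algebra K A\<^sub>2 dot\<^sub>2 star\<^sub>2 \<alpha>\<^sub>2"
  shows "\<exists>dot star \<alpha>. is_tensor_double_hom_algebra K A\<^sub>1 dot\<^sub>1 star\<^sub>1 \<alpha>\<^sub>1 A\<^sub>2 dot\<^sub>2 star\<^sub>2 \<alpha>\<^sub>2 dot star \<alpha>"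
proof -
  interpret H\<^sub>1: double_hom_algebra K A\<^sub>1 dot\<^sub>1 star\<^sub>1 \<alpha>\<^sub>1 by fact
  interpret H\<^sub>2: double_hom_algebra K A\<^sub>2 dot\<^sub>2 star\<^sub>2 \<alpha>\<^sub>2 by fact
  interpret tensor_product K A\<^sub>1 A\<^sub>2 ..
  obtain \<alpha> where \<alpha>: "linear_map K T T \<alpha>"
    and \<alpha>_pure: "\<And>x y. \<lbrakk>x \<in> carrier A\<^sub>1; y \<in> carrier A\<^sub>2\<rbrakk> \<Longrightarrow> \<alpha> (t x y) = t (\<alpha>\<^sub>1 x) (\<alpha>\<^sub>2 y)"
    by (rule tensor_product_linear_maps[OF H\<^sub>1.dot.twist_linear H\<^sub>2.dot.twist_linear]) (rule that)
  obtain dot where dot: "bilinear_map K T T T dot"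
    and dot_pure: "\<And>x y x' y'. \<lbrakk>x \<in> carrier A\<^sub>1; y \<in> carrier A\<^sub>2; x' \<in> carrier A\<^sub>1; y' \<in> carrier A\<^sub>2\<rbrakk>
      \<Longrightarrow> dot (t x y) (t x' y') = t (dot\<^sub>1 x x') (dot\<^sub>2 y y')"
    by (rule tensor_product_bilinear_maps[OF H\<^sub>1.dot.mul_bilinear H\<^sub>2.dot.mul_bilinear]) (rule that)
  obtain s where s: "bilinear_map K T T T s"
    and s_pure: "\<And>x y x' y'. \<lbrakk>x \<in> carrier A\<^sub>1; y \<in> carrier A\<^sub>2; x' \<in> carrier A\<^sub>1; y' \<in> carrier A\<^sub>2\<rbrakk>
      \<Longrightarrow> s (t x y) (t x' y') = t (star\<^sub>1 x x') (dot\<^sub>2 y y')"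
    by (rule tensor_product_bilinear_maps[OF H\<^sub>1.star.mul_bilinear H\<^sub>2.dot.mul_bilinear]) (rule that)
  obtain s' where s': "bilinear_map K T T T s'"
    and s'_pure: "\<And>x y x' y'. \<lbrakk>x \<in> carrier A\<^sub>1; y \<in> carrier A\<^sub>2; x' \<in> carrier A\<^sub>1; y' \<in> carrier A\<^sub>2\<rbrakk>
      \<Longrightarrow> s' (t x y) (t x' y') = t (dot\<^sub>1 x x') (star\<^sub>2 y y')"
    by (rule tensor_product_bilinear_maps[OF H\<^sub>1.dot.mul_bilinear H\<^sub>2.star.mul_bilinear]) (rule that)
  have "double_hom_algebra K T dot (\<lambda>u v. s u v \<oplus>\<^bsub>T\<^esub> s' u v) \<alpha>"
    using T.vectorspace_axioms \<alpha> dot bilinear_map_add[OF s s'] by (rule double_hom_algebraI)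
  then have "is_tensor_double_hom_algebra K A\<^sub>1 dot\<^sub>1 star\<^sub>1 \<alpha>\<^sub>1 A\<^sub>2 dot\<^sub>2 star\<^sub>2 \<alpha>\<^sub>2
      dot (\<lambda>u v. s u v \<oplus>\<^bsub>T\<^esub> s' u v) \<alpha>"
    by (simp add: is_tensor_double_hom_algebra_def Let_def \<alpha>_pure dot_pure s_pure s'_pure)
  then show ?thesis by blast
qed

lemma is_tensor_double_hom_algebra_imp_locale:
  assumes H1: "double_hom_algebra K A\<^sub>1 dot\<^sub>1 star\<^sub>1 \<alpha>\<^sub>1" and H2: "double_hom_algebra K A\<^sub>2 dot\<^sub>2 star\<^sub>2 \<alpha>\<^sub>2"
    and A: "is_tensor_double_hom_algebra K A\<^sub>1 dot\<^sub>1 star\<^sub>1 \<alpha>\<^sub>1 A\<^sub>2 dot\<^sub>2 star\<^sub>2 \<alpha>\<^sub>2 dot star \<alpha>"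
  shows "tensor_double_hom_algebra K A\<^sub>1 dot\<^sub>1 star\<^sub>1 \<alpha>\<^sub>1 A\<^sub>2 dot\<^sub>2 star\<^sub>2 \<alpha>\<^sub>2 dot star \<alpha>"
proof -
  interpret H\<^sub>1: double_hom_algebra K A\<^sub>1 dot\<^sub>1 star\<^sub>1 \<alpha>\<^sub>1 by fact
  interpret H\<^sub>2: double_hom_algebra K A\<^sub>2 dot\<^sub>2 star\<^sub>2 \<alpha>\<^sub>2 by fact
  have "tensor_product K A\<^sub>1 A\<^sub>2" ..
  then show ?thesis
    using H1 H2 A
    by (intro tensor_double_hom_algebra.intro tensor_double_hom_algebra_axioms.intro)
      (simp_all add: is_tensor_double_hom_algebra_def Let_def)
qed

theorem theorem3p1:
  fixes K :: "('k, 'r) ring_scheme"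
    and A\<^sub>1 :: "('k, 'a, 'm) module_scheme" and A\<^sub>2 :: "('k, 'b, 'n) module_scheme"
    and dot\<^sub>1 star\<^sub>1 :: "'a \<Rightarrow> 'a \<Rightarrow> 'a" and \<alpha>\<^sub>1 :: "'a \<Rightarrow> 'a"
    and dot\<^sub>2 star\<^sub>2 :: "'b \<Rightarrow> 'b \<Rightarrow> 'b" and \<alpha>\<^sub>2 :: "'b \<Rightarrow> 'b"
  assumes "field K"
    and char_zero: "\<And>n :: nat. n > 0 \<Longrightarrow> [n] \<cdot>\<^bsub>K\<^esub> \<one>\<^bsub>K\<^esub> \<noteq> \<zero>\<^bsub>K\<^esub>"
    and "hom_novikov_poisson_algebra K A\<^sub>1 dot\<^sub>1 star\<^sub>1 \<alpha>\<^sub>1"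
    and "hom_novikov_poisson_algebra K A\<^sub>2 dot\<^sub>2 star\<^sub>2 \<alpha>\<^sub>2"
  shows "(\<exists>dot star \<alpha>.
            is_tensor_double_hom_algebra K A\<^sub>1 dot\<^sub>1 star\<^sub>1 \<alpha>\<^sub>1 A\<^sub>2 dot\<^sub>2 star\<^sub>2 \<alpha>\<^sub>2 dot star \<alpha>) \<and>
         (\<forall>dot star \<alpha>.
            is_tensor_double_hom_algebra K A\<^sub>1 dot\<^sub>1 star\<^sub>1 \<alpha>\<^sub>1 A\<^sub>2 dot\<^sub>2 star\<^sub>2 \<alpha>\<^sub>2 dot star \<alpha> \<longrightarrow>
              hom_novikov_poisson_algebra K (tensor_space K A\<^sub>1 A\<^sub>2) dot star \<alpha> \<and>
              (multiplicative_double_hom_algebra K A\<^sub>1 dot\<^sub>1 star\<^sub>1 \<alpha>\<^sub>1 \<and>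
               multiplicative_double_hom_algebra K A\<^sub>2 dot\<^sub>2 star\<^sub>2 \<alpha>\<^sub>2 \<longrightarrow>
               multiplicative_double_hom_algebra K (tensor_space K A\<^sub>1 A\<^sub>2) dot star \<alpha>))"
proof (intro conjI allI impI)
  note H = assms(3,4)[THEN hom_novikov_poisson_algebra.axioms(1)]
  show "\<exists>dot star \<alpha>. is_tensor_double_hom_algebra K A\<^sub>1 dot\<^sub>1 star\<^sub>1 \<alpha>\<^sub>1 A\<^sub>2 dot\<^sub>2 star\<^sub>2 \<alpha>\<^sub>2 dot star \<alpha>"
    using H by (rule tensor_double_hom_algebra_exists)
  fix dot star \<alpha>
  assume "is_tensor_double_hom_algebra K A\<^sub>1 dot\<^sub>1 star\<^sub>1 \<alpha>\<^sub>1 A\<^sub>2 dot\<^sub>2 star\<^sub>2 \<alpha>\<^sub>2 dot star \<alpha>"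
  with H have A: "tensor_double_hom_algebra K A\<^sub>1 dot\<^sub>1 star\<^sub>1 \<alpha>\<^sub>1 A\<^sub>2 dot\<^sub>2 star\<^sub>2 \<alpha>\<^sub>2 dot star \<alpha>"
    by (rule is_tensor_double_hom_algebra_imp_locale)
  show "hom_novikov_poisson_algebra K (tensor_space K A\<^sub>1 A\<^sub>2) dot star \<alpha>"
    using A assms(3,4)
    by (intro tensor_hom_novikov_poisson_algebra.hom_novikov_poisson
        tensor_hom_novikov_poisson_algebra.intro)
  assume "multiplicative_double_hom_algebra K A\<^sub>1 dot\<^sub>1 star\<^sub>1 \<alpha>\<^sub>1 \<and>
    multiplicative_double_hom_algebra K A\<^sub>2 dot\<^sub>2 star\<^sub>2 \<alpha>\<^sub>2"
  then show "multiplicative_double_hom_algebra K (tensor_space K A\<^sub>1 A\<^sub>2) dot star \<alpha>"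
    using tensor_double_hom_algebra.multiplicative[OF A] by blast
qed

end
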